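(* There exists a sequence of parameter angles $\theta_3,\theta_4,\ldots\in(0,\frac{\pi}{4})$ with $\theta_K\to\frac{\pi}{4}$ as $K\to\infty$, such that for each integer $K\ge 3$ the map $F_{\theta_K}\colon\mathcal S\to\mathcal S$ has a countable collection of invariant circles $\{\Gamma_K^N : N\ge 0\}$ with rational rotation numbers $$\rho(\Gamma_K^N)=\frac{1}{4(K+N)},\qquad N\ge 0.$$ Each curve $\Gamma_K^N$ consists of (finitely many) straight line segments and is rotationally symmetric, and for each fixed $K$ the curves $\Gamma_K^N$ converge to the boundary $\partial\mathcal S$ (in the Hausdorff metric) as $N\to\infty$.
   Context: The map $F_\theta$. Let $\mathcal S=[0,1]\times[0,1]$, $Z=(\frac12,\frac12)$, $E_1=(0,0)$, $E_2=(1,0)$, $E_3=(1,1)$, $E_4=(0,1)$. Indices $i\in\{1,2,3,4\}$ are cyclic. For $\theta\in(0,\frac{\pi}{4})$ let $L_i$ be the ray from $E_i$ into $\mathcal S$ making angle $\theta$ with the segment $\overline{E_iE_{i+1}}$, and $P_i=L_{i-1}\cap L_i$. With $t=\sin^2\theta$, $s=\sin\theta\cos\theta$ this gives $P_1=(s,t)$, $P_2=(1-t,s)$, $P_3=(1-s,1-t)$, $P_4=(t,1-s)$. Put $P_1'=(1-s,t)$, $P_2'=(1-t,1-s)$, $P_3'=(s,1-t)$, $P_4'=(t,s)$. The square $\mathcal S$ is partitioned (up to boundaries) into the closed triangles $\mathcal A_i=\Delta(E_i,E_{i+1},P_i)$, $\mathcal B_i=\Delta(E_i,P_i,P_{i-1})$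 and the closed square $\mathcal C=\square(P_1,P_2,P_3,P_4)$; likewise into $\mathcal A_i'=\Delta(E_i,E_{i+1},P_i')$, $\mathcal B_i'=\Delta(E_i,P_i',P_{i-1}')$, $\mathcal C'=\square(P_1',P_2',P_3',P_4')$. The map $F=F_\theta\colon\mathcal S\to\mathcal S$ is the unique map with $F(E_i)=E_i$, $F(P_i)=P_i'$ for all $i$ that is affine on each of the nine pieces $\mathcal A_i,\mathcal B_i,\mathcal C$; it is an orientation- and area-preserving homeomorphism of $\mathcal S$, equal to the identity on $\partial\mathcal S$. An invariant circle is a simple closed curve $\Gamma\subset\mathcal S$ with $F(\Gamma)=\Gamma$. Its rotation number $\rho(\Gamma)=\rho_\Gamma\in[0,1)$ is the rotation number of the circle homeomorphism $F|_\Gamma$, with $\Gamma$ oriented counterclockwise. Let $R$ be the (counterclockwise) rotation about $Z$ by $\frac{\pi}{2}$. An invariant circle $\Gamma$ is rotationally symmetric if it encircles $Z$, $F|_\Gamma$ preserves the cyclic ($S^1$-)order of points of $\Gamma$, and $R(\Gamma)=\Gamma$. *)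

theory Defs
  imports "HOL-Complex_Analysis.Complex_Analysis"
begin

text \<open>The plane is identified with the complex numbers, \<open>Complex x y\<close> being the point \<open>(x, y)\<close>.
  The cyclic indices \<open>1, 2, 3, 4\<close> are natural numbers read modulo 4, so that list position 0
  carries index 4 and the predecessor of \<open>i\<close> is \<open>i + 3\<close>.\<close>

definition Sq :: "complex set" where
  "Sq = {z. 0 \<le> Re z \<and> Re z \<le> 1 \<and> 0 \<le> Im z \<and> Im z \<le> 1}"

definition Zc :: complex where
  "Zc = Complex (1/2) (1/2)"

definition E :: "nat \<Rightarrow> complex" where
  "E i = [Complex 0 1, Complex 0 0, Complex 1 0, Complex 1 1] ! (i mod 4)"

text \<open>\<open>P \<theta> i\<close> is the intersection of the rays \<open>L (i - 1)\<close> and \<open>L i\<close>, where \<open>L i\<close> issues from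
  \<open>E i\<close> into the square at angle \<open>\<theta>\<close> with the side from \<open>E i\<close> to \<open>E (i + 1)\<close>.\<close>

definition P :: "real \<Rightarrow> nat \<Rightarrow> complex" where
  "P \<theta> i = (let t = (sin \<theta>)\<^sup>2; s = sin \<theta> * cos \<theta> in
     [Complex t (1 - s), Complex s t, Complex (1 - t) s, Complex (1 - s) (1 - t)] ! (i mod 4))"

definition P' :: "real \<Rightarrow> nat \<Rightarrow> complex" where
  "P' \<theta> i = (let t = (sin \<theta>)\<^sup>2; s = sin \<theta> * cos \<theta> in
     [Complex t s, Complex (1 - s) t, Complex (1 - t) (1 - s), Complex s (1 - t)] ! (i mod 4))"

definition pieceA :: "real \<Rightarrow> nat \<Rightarrow> complex set" where
  "pieceA \<theta> i = convex hull {E i, E (i + 1), P \<theta> i}"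

definition pieceB :: "real \<Rightarrow> nat \<Rightarrow> complex set" where
  "pieceB \<theta> i = convex hull {E i, P \<theta> i, P \<theta> (i + 3)}"

definition pieceC :: "real \<Rightarrow> complex set" where
  "pieceC \<theta> = convex hull {P \<theta> 1, P \<theta> 2, P \<theta> 3, P \<theta> 4}"

definition affine_map_on :: "complex set \<Rightarrow> (complex \<Rightarrow> complex) \<Rightarrow> bool" where
  "affine_map_on T f \<longleftrightarrow> (\<exists>g c. linear g \<and> (\<forall>z\<in>T. f z = g z + c))"

text \<open>The map of the square, made extensional (\<open>undefined\<close> off the square) so that it is unique
  as a function on all of \<open>complex\<close>.\<close>

definition F :: "real \<Rightarrow> complex \<Rightarrow> complex" where
  "F \<theta> = (THE f. f \<in> Sq \<rightarrow>\<^sub>E Sq \<and>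
     (\<forall>i. f (E i) = E i \<and> f (P \<theta> i) = P' \<theta> i) \<and>
     (\<forall>i. affine_map_on (pieceA \<theta> i) f \<and> affine_map_on (pieceB \<theta> i) f) \<and>
     affine_map_on (pieceC \<theta>) f)"

definition simple_closed_curve :: "complex set \<Rightarrow> bool" where
  "simple_closed_curve \<Gamma> \<longleftrightarrow>
     (\<exists>\<gamma>. simple_path \<gamma> \<and> pathfinish \<gamma> = pathstart \<gamma> \<and> path_image \<gamma> = \<Gamma>)"

definition invariant_circle :: "(complex \<Rightarrow> complex) \<Rightarrow> complex set \<Rightarrow> bool" where
  "invariant_circle f \<Gamma> \<longleftrightarrow> simple_closed_curve \<Gamma> \<and> \<Gamma> \<subseteq> Sq \<and> f ` \<Gamma> = \<Gamma>"

definition ccw_parametrization :: "(real \<Rightarrow> complex) \<Rightarrow> complex set \<Rightarrow> bool" where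
  "ccw_parametrization \<gamma> \<Gamma> \<longleftrightarrow>
     simple_path \<gamma> \<and> pathfinish \<gamma> = pathstart \<gamma> \<and> path_image \<gamma> = \<Gamma> \<and>
     (\<forall>z\<in>inside \<Gamma>. winding_number \<gamma> z = 1)"

text \<open>\<open>h\<close> lifts the restriction of \<open>f\<close> to the curve, along the covering \<open>x \<mapsto> \<gamma> (frac x)\<close>,
  to an orientation-preserving homeomorphism of the line commuting with translation by 1.\<close>

definition circle_lift ::
    "(complex \<Rightarrow> complex) \<Rightarrow> (real \<Rightarrow> complex) \<Rightarrow> (real \<Rightarrow> real) \<Rightarrow> bool" where
  "circle_lift f \<gamma> h \<longleftrightarrow>
     continuous_on UNIV h \<and> strict_mono h \<and> (\<forall>x. h (x + 1) = h x + 1) \<and>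
     (\<forall>x. f (\<gamma> (frac x)) = \<gamma> (frac (h x)))"

text \<open>Poincare's rotation number, the translation number of a lift modulo 1.  It depends neither
  on the counterclockwise parametrization nor on the lift, so, as with \<open>has_integral\<close>, the
  existential quantifiers determine at most one value \<open>\<rho>\<close>.\<close>

definition has_rotation_number ::
    "(complex \<Rightarrow> complex) \<Rightarrow> complex set \<Rightarrow> real \<Rightarrow> bool" where
  "has_rotation_number f \<Gamma> \<rho> \<longleftrightarrow>
     (\<exists>\<gamma> h L. ccw_parametrization \<gamma> \<Gamma> \<and> circle_lift f \<gamma> h \<and>
        (\<forall>x. (\<lambda>n. (h ^^ n) x / real n) \<longlonglongrightarrow> L) \<and> \<rho> = frac L)"

definition cyclically_ordered :: "real \<Rightarrow> real \<Rightarrow> real \<Rightarrow> bool" where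
  "cyclically_ordered x y z \<longleftrightarrow> x < y \<and> y < z \<or> y < z \<and> z < x \<or> z < x \<and> x < y"

text \<open>Reparametrizing a simple closed curve preserves or reverses the cyclic order of all triples
  simultaneously, so the choice of \<open>\<gamma>\<close> is immaterial.\<close>

definition preserves_cyclic_order_on :: "complex set \<Rightarrow> (complex \<Rightarrow> complex) \<Rightarrow> bool" where
  "preserves_cyclic_order_on \<Gamma> f \<longleftrightarrow>
     (\<exists>\<gamma>. simple_path \<gamma> \<and> pathfinish \<gamma> = pathstart \<gamma> \<and> path_image \<gamma> = \<Gamma> \<and>
        (\<forall>x\<in>{0..<1}. \<forall>y\<in>{0..<1}. \<forall>z\<in>{0..<1}. cyclically_ordered x y z \<longrightarrow>
           (\<exists>x'\<in>{0..<1}. \<exists>y'\<in>{0..<1}. \<exists>z'\<in>{0..<1}. cyclically_ordered x' y' z' \<and>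
              f (\<gamma> x) = \<gamma> x' \<and> f (\<gamma> y) = \<gamma> y' \<and> f (\<gamma> z) = \<gamma> z')))"

definition R :: "complex \<Rightarrow> complex" where
  "R z = Zc + \<i> * (z - Zc)"

definition rotationally_symmetric :: "(complex \<Rightarrow> complex) \<Rightarrow> complex set \<Rightarrow> bool" where
  "rotationally_symmetric f \<Gamma> \<longleftrightarrow>
     Zc \<in> inside \<Gamma> \<and> preserves_cyclic_order_on \<Gamma> f \<and> R ` \<Gamma> = \<Gamma>"

definition finite_union_of_segments :: "complex set \<Rightarrow> bool" where
  "finite_union_of_segments \<Gamma> \<longleftrightarrow>
     (\<exists>T. finite T \<and> (\<forall>(a, b)\<in>T. a \<noteq> b) \<and> \<Gamma> = (\<Union>(a, b)\<in>T. closed_segment a b))"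

text \<open>Meaningful for nonempty bounded sets, which is all it is used for.\<close>

definition hausdorff_dist :: "complex set \<Rightarrow> complex set \<Rightarrow> real" where
  "hausdorff_dist A B = max (SUP a\<in>A. infdist a B) (SUP b\<in>B. infdist b A)"

end

theory Submission
  imports Defs
begin

text \<open>On \<open>\<A>\<^sub>1\<close> the map is a horizontal shear, and on \<open>\<B>\<^sub>1\<close> it is a linear hyperbolic map \<open>M\<close>.  If
  \<open>M ^ K\<close> maps \<open>P 4\<close> to \<open>P 1\<close>, then for suitable \<open>\<lambda>\<close> the orbit of \<open>\<lambda> P 4\<close> turns the corner at \<open>E 1\<close>
  in \<open>K\<close> steps, continues along the horizontal line at height \<open>\<lambda> t\<close>, and after \<open>N\<close> further steps hits
  the rotated starting point \<open>R (\<lambda> P 4)\<close>; this fixes \<open>\<lambda> = 1 / (N (1 - 2 s) + 1)\<close>.  As \<open>F\<close> commutes with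
  \<open>R\<close>, the orbit is periodic with period \<open>4 (K + N)\<close>, and as \<open>F\<close> is affine on each segment joining
  consecutive points, the polygon through the orbit is invariant and \<open>F\<close> acts on it as a rigid
  rotation by one side.  The coordinates of \<open>M ^ j (P 4)\<close> satisfy a linear recursion governed by the trace of
  \<open>M\<close>, and \<open>M ^ K (P 4) = P 1\<close> becomes a scalar equation in \<open>\<theta>\<close>, which the intermediate value
  theorem solves on \<open>[\<pi>/8, \<pi>/4)\<close>; for \<open>K = 3\<close> the solution is \<open>\<pi>/8\<close>.\<close>

section \<open>The plane, the rotation and affine maps\<close>

text \<open>\<open>F\<close> is a definite description, so no orbit can be followed before the
  affine formulas are known to cover the square and to agree wherever pieces overlap; the fourfold
  symmetry reduces agreement to overlaps involving a piece of index 1. That the vector equation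
  \<open>M ^ K (P 4) = P 1\<close> costs only one scalar condition is due to reversibility:
  \<open>M\<close> has determinant 1 and opposite off-diagonal entries, so exchanging the
  coordinates conjugates \<open>M\<close> to its inverse. The exchange carries \<open>P 4\<close> to
  \<open>M (P 1)\<close>, hence the second coordinates of the orbit are the first coordinates read
  backwards. The angles tend to pi/4 because the closing equation makes
  \<open>1 - sin (2 * \<theta>)\<close> the reciprocal of a quantity that is at least
  \<open>K - 1\<close>. A rotation number requires a counterclockwise simple parametrization.
  Star-shapedness provides it: seen from the centre, the angle increases strictly along the orbit,
  and a quarter of the polygon spans exactly a right angle.\<close>

definition real_affine :: "(complex \<Rightarrow> complex) \<Rightarrow> bool" where
  "real_affine f \<longleftrightarrow> (\<exists>g c. linear g \<and> f = (\<lambda>z. g z + c))"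

lemma real_affine_linear: "linear g \<Longrightarrow> real_affine (\<lambda>z. g z + c)"
  unfolding real_affine_def by blast

lemma real_affine_compose:
  assumes "real_affine f" "real_affine g"
  shows "real_affine (\<lambda>z. f (g z))"
proof -
  obtain lf cf lg cg where "linear lf" "f = (\<lambda>z. lf z + cf)" "linear lg" "g = (\<lambda>z. lg z + cg)"
    using assms unfolding real_affine_def by blast
  then have "linear (lf \<circ> lg)" "(\<lambda>z. f (g z)) = (\<lambda>z. (lf \<circ> lg) z + (lf cg + cf))"
    by (auto simp: linear_compose linear_add fun_eq_iff)
  then show ?thesis unfolding real_affine_def by blast
qed

lemma real_affine_funpow: "real_affine f \<Longrightarrow> real_affine (f ^^ n)"
proof (induction n)
  case 0
  have "real_affine (\<lambda>z. id z + 0)" by (rule real_affine_linear[OF linear_id])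
  then show ?case by (simp add: id_def)
next
  case (Suc n)
  have "(\<lambda>z. f ((f ^^ n) z)) = f ^^ Suc n" by auto
  then show ?case using real_affine_compose[OF Suc.prems Suc.IH[OF Suc.prems]] by metis
qed

lemma real_affine_sum:
  assumes "real_affine f" "finite S" "sum u S = 1"
  shows "f (\<Sum>v\<in>S. u v *\<^sub>R v) = (\<Sum>v\<in>S. u v *\<^sub>R f v)"
proof -
  obtain g c where g: "linear g" "f = (\<lambda>z. g z + c)"
    using assms(1) unfolding real_affine_def by blast
  have "(\<Sum>v\<in>S. u v *\<^sub>R f v) = (\<Sum>v\<in>S. u v *\<^sub>R g v) + sum u S *\<^sub>R c"
    by (simp add: g(2) scaleR_add_right sum.distrib scaleR_left.sum)
  then show ?thesis
    using assms(3) g by (simp add: linear_sum linear_scale)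
qed

lemma real_affine_segment:
  assumes "real_affine f"
  shows "f ((1 - u) *\<^sub>R x + u *\<^sub>R y) = (1 - u) *\<^sub>R f x + u *\<^sub>R f y"
proof -
  obtain g c where g: "linear g" "f = (\<lambda>z. g z + c)"
    using assms unfolding real_affine_def by blast
  then show ?thesis
    by (simp add: linear_add linear_diff linear_scale scaleR_diff_left scaleR_diff_right scaleR_add_right)
qed

text \<open>Affine maps commute with convex combinations, so vertex values propagate to the hull.
  This is the source of the uniqueness of \<open>F\<close>.\<close>

lemma affine_map_on_hull_eq:
  assumes "affine_map_on (convex hull V) f" "real_affine g" "finite V"
    and "\<And>v. v \<in> V \<Longrightarrow> f v = g v" "z \<in> convex hull V"
  shows "f z = g z"
proof -
  obtain l c where l: "linear l" "\<And>z. z \<in> convex hull V \<Longrightarrow> f z = l z + c"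
    using assms(1) unfolding affine_map_on_def by blast
  define f' where "f' = (\<lambda>z. l z + c)"
  have f': "real_affine f'" unfolding f'_def by (rule real_affine_linear[OF l(1)])
  obtain u where u: "sum u V = 1" "(\<Sum>v\<in>V. u v *\<^sub>R v) = z"
    using assms(5) by (auto simp: convex_hull_finite[OF assms(3)])
  have "f' v = g v" if "v \<in> V" for v
    using l(2)[of v] assms(4)[OF that] hull_inc[OF that, of convex] by (simp add: f'_def)
  then have "f' z = g z"
    using real_affine_sum[OF f' assms(3) u(1)] real_affine_sum[OF assms(2,3) u(1)] u(2) by simp
  then show ?thesis using l(2)[OF assms(5)] by (simp add: f'_def)
qed

text \<open>The affine functional \<open>z \<mapsto> p Re z + q Im z + r\<close> separates the two hulls, so that their
  intersection is spanned by the vertices of \<open>V\<close> on the separating line.\<close>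

lemma real_affine_eq_on_separated_hulls:
  assumes fg: "real_affine f" "real_affine g" and fin: "finite V"
    and V: "\<And>v. v \<in> V \<Longrightarrow> p * Re v + q * Im v + r \<ge> (0::real)"
    and W: "\<And>v. v \<in> W \<Longrightarrow> p * Re v + q * Im v + r \<le> 0"
    and VW: "\<And>v. v \<in> V \<Longrightarrow> p * Re v + q * Im v + r = 0 \<Longrightarrow> f v = g v"
    and z: "z \<in> convex hull V" "z \<in> convex hull W"
  shows "f z = g z"
proof -
  obtain u where u: "\<And>v. v \<in> V \<Longrightarrow> u v \<ge> 0" "sum u V = 1" "(\<Sum>v\<in>V. u v *\<^sub>R v) = z"
    using z(1) by (auto simp: convex_hull_finite[OF fin])
  have "convex {v. inner (Complex p q) v \<le> - r}"
    by (rule convex_halfspace_le)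
  moreover have "inner (Complex p q) v = p * Re v + q * Im v" for v
    by (simp add: inner_complex_def)
  ultimately have "convex hull W \<subseteq> {v. p * Re v + q * Im v \<le> - r}"
    using W by (intro hull_minimal) (auto, smt (verit))
  then have le: "p * Re z + q * Im z + r \<le> 0" using z(2) by auto
  have "(\<Sum>v\<in>V. u v * (p * Re v + q * Im v + r))
      = p * (\<Sum>v\<in>V. u v * Re v) + q * (\<Sum>v\<in>V. u v * Im v) + r * sum u V"
    by (simp add: algebra_simps sum.distrib sum_distrib_left)
  also have "\<dots> = p * Re z + q * Im z + r"
    by (simp add: u(2) flip: u(3))
  finally have "(\<Sum>v\<in>V. u v * (p * Re v + q * Im v + r)) \<le> 0" using le by simp
  moreover have nn: "0 \<le> u v * (p * Re v + q * Im v + r)" if "v \<in> V" for v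
    using u(1) V that by simp
  ultimately have "(\<Sum>v\<in>V. u v * (p * Re v + q * Im v + r)) = 0"
    by (simp add: order_antisym sum_nonneg)
  then have "\<forall>v\<in>V. u v * (p * Re v + q * Im v + r) = 0"
    by (rule iffD1[OF sum_nonneg_eq_0_iff[OF fin nn], rotated])
  then have "u v = 0 \<or> p * Re v + q * Im v + r = 0" if "v \<in> V" for v
    using that mult_eq_0_iff by blast
  then have "(\<Sum>v\<in>V. u v *\<^sub>R f v) = (\<Sum>v\<in>V. u v *\<^sub>R g v)"
    using VW by (intro sum.cong refl) force
  then show ?thesis
    using real_affine_sum[OF fg(1) fin u(2)] real_affine_sum[OF fg(2) fin u(2)] u(3) by simp
qed

lemma R_Complex: "R (Complex x y) = Complex (1 - y) x"
  by (simp add: R_def Zc_def complex_eq_iff)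

lemma Re_R [simp]: "Re (R z) = 1 - Im z" and Im_R [simp]: "Im (R z) = Re z"
  by (simp_all add: R_def Zc_def)

lemma R_power4 [simp]: "R (R (R (R z))) = z"
  by (simp add: complex_eq_iff)

lemma real_affine_R: "real_affine R"
proof -
  have "R = (\<lambda>z. \<i> * z + (Zc - \<i> * Zc))" by (auto simp: R_def algebra_simps)
  moreover have "linear ((*) \<i>)" by (simp add: linear_times)
  ultimately show ?thesis using real_affine_linear by metis
qed

lemma funpow_R_mod4: "(R ^^ n) z = (R ^^ (n mod 4)) z"
proof -
  have "R ^^ 4 = id" by (rule ext) (simp add: numeral_eq_Suc)
  then have "(R ^^ 4) ^^ (n div 4) = id" using id_funpow by metis
  moreover have "R ^^ n = (R ^^ 4) ^^ (n div 4) \<circ> R ^^ (n mod 4)"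
    by (metis funpow_add funpow_mult mult_div_mod_eq)
  ultimately show ?thesis by simp
qed

lemma funpow_R_cancel: "n mod 4 = 0 \<Longrightarrow> (R ^^ n) z = z"
  by (subst funpow_R_mod4) simp

lemma R_Sq_iff [simp]: "R z \<in> Sq \<longleftrightarrow> z \<in> Sq"
  by (auto simp: Sq_def)

lemma mod4_cases: "(i::nat) mod 4 = 0 \<or> i mod 4 = 1 \<or> i mod 4 = 2 \<or> i mod 4 = 3"
  by presburger

lemma Suc_mod4:
  "i mod 4 = 0 \<Longrightarrow> Suc i mod 4 = 1" "i mod 4 = 1 \<Longrightarrow> Suc i mod 4 = 2"
  "i mod 4 = 2 \<Longrightarrow> Suc i mod 4 = 3" "i mod 4 = 3 \<Longrightarrow> Suc i mod 4 = 0"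
  by presburger+

lemma E_Suc: "E (Suc i) = R (E i)"
  using mod4_cases[of i] by (auto simp: E_def Suc_mod4 R_Complex)

lemma P_Suc: "P \<theta> (Suc i) = R (P \<theta> i)"
  using mod4_cases[of i] by (auto simp: P_def Let_def Suc_mod4 R_Complex)

lemma P'_Suc: "P' \<theta> (Suc i) = R (P' \<theta> i)"
  using mod4_cases[of i] by (auto simp: P'_def Let_def Suc_mod4 R_Complex)

lemma cyclic_add:
  assumes "\<And>i. X (Suc i) = R (X i)"
  shows "X (n + i) = (R ^^ n) (X i)"
  using assms by (induction n) auto

lemma cyclic_mod4:
  assumes "\<And>i. X (Suc i) = R (X i)" "i mod 4 = j mod 4"
  shows "X i = X j"
proof -
  have "X n = (R ^^ n) (X 0)" for n
    by (induction n) (simp_all add: assms(1))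
  then show ?thesis using assms(2) by (metis funpow_R_mod4)
qed

text \<open>Naming the two numbers turns the geometry into polynomial identities in \<open>s\<close>
  and \<open>t\<close>, with the relation \<open>st\<close> in place of trigonometry. The
  inequalities are what an angle in (0, pi/4) provides.\<close>

locale pinwheel =
  fixes \<theta> s t :: real
  assumes s_def: "s = sin \<theta> * cos \<theta>" and t_def: "t = (sin \<theta>)\<^sup>2"
    and t_pos: "0 < t" and t_less_s: "t < s" and s_less: "s < 1/2"
begin

lemma st: "s\<^sup>2 + t\<^sup>2 = t"
proof -
  have "s\<^sup>2 + t\<^sup>2 = (sin \<theta>)\<^sup>2 * ((cos \<theta>)\<^sup>2 + (sin \<theta>)\<^sup>2)"
    unfolding s_def t_def by algebra
  then show ?thesis by (simp add: t_def)
qed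

lemma P_simps:
  "P \<theta> 0 = Complex t (1 - s)" "P \<theta> (Suc 0) = Complex s t" "P \<theta> 1 = Complex s t" "P \<theta> 2 = Complex (1 - t) s"
  "P \<theta> 3 = Complex (1 - s) (1 - t)" "P \<theta> 4 = Complex t (1 - s)"
  by (simp_all add: P_def s_def t_def)

lemma P'_simps:
  "P' \<theta> 0 = Complex t s" "P' \<theta> 1 = Complex (1 - s) t" "P' \<theta> 2 = Complex (1 - t) (1 - s)"
  "P' \<theta> 3 = Complex s (1 - t)" "P' \<theta> 4 = Complex t s"
  by (simp_all add: P'_def s_def t_def)

end

lemma E_simps:
  "E 0 = Complex 0 1" "E (Suc 0) = Complex 0 0" "E 1 = Complex 0 0" "E 2 = Complex 1 0" "E 3 = Complex 1 1" "E 4 = Complex 0 1"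
  by (simp_all add: E_def)

section \<open>The nine affine pieces\<close>

context pinwheel
begin

definition MA :: "complex \<Rightarrow> complex" where
  "MA z = Complex (Re z + (1 - 2 * s) / t * Im z) (Im z)"

text \<open>The matrix with \<open>P \<theta> 1\<close> sent to \<open>P' \<theta> 1\<close> and
  \<open>P \<theta> 4\<close> to \<open>P' \<theta> 4\<close>; the common denominator
  \<open>s - t\<close> is the determinant of the two preimages. Its own determinant is 1.\<close>

definition MB :: "complex \<Rightarrow> complex" where
  "MB z = Complex
     ((1 - s - t) * (1 - s + t) / (s - t) * Re z + - (t * (1 - 2 * s)) / (s - t) * Im z)
     (t * (1 - 2 * s) / (s - t) * Re z + (s + t) * Im z)"

text \<open>The factor is \<open>sin (2 * \<theta>) + \<i> * cos (2 * \<theta>)\<close>, so this is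
  the rotation about the centre by the angle \<open>pi/2 - 2 * \<theta>\<close>.\<close>

definition MC :: "complex \<Rightarrow> complex" where
  "MC z = Zc + Complex (2 * s) (1 - 2 * t) * (z - Zc)"

text \<open>The kinds 0, 1, 2 stand for the pieces \<open>\<A>\<^sub>i\<close>, \<open>\<B>\<^sub>i\<close> and \<open>\<C>\<close>.\<close>

definition verts :: "nat \<Rightarrow> nat \<Rightarrow> complex set" where
  "verts k i = (if k = 0 then {E i, E (i + 1), P \<theta> i}
     else if k = 1 then {E i, P \<theta> i, P \<theta> (i + 3)}
     else {P \<theta> i, P \<theta> (i + 1), P \<theta> (i + 2), P \<theta> (i + 3)})"

definition piece_map0 :: "nat \<Rightarrow> complex \<Rightarrow> complex" where
  "piece_map0 k = (if k = 0 then MA else if k = 1 then MB else MC)"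

text \<open>Conjugate by \<open>R ^ (i - 1)\<close>, the exponents being taken modulo 4.\<close>

definition piece_map :: "nat \<Rightarrow> nat \<Rightarrow> complex \<Rightarrow> complex" where
  "piece_map k i z = (R ^^ (i + 3)) (piece_map0 k ((R ^^ (3 * i + 1)) z))"

text \<open>The prescribed value at a vertex as a function of the point rather than of its index.
  This is possible because \<open>MC\<close> sends every \<open>P \<theta> i\<close> to
  \<open>P' \<theta> i\<close>.\<close>

definition target :: "complex \<Rightarrow> complex" where
  "target v = (if v \<in> range E then v else MC v)"

lemma range_E: "range E = {Complex 0 0, Complex 1 0, Complex 1 1, Complex 0 1}"
proof -
  have "E i \<in> {Complex 0 0, Complex 1 0, Complex 1 1, Complex 0 1}" for i
    using mod4_cases[of i] by (auto simp: E_def)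
  moreover have "{Complex 0 0, Complex 1 0, Complex 1 1, Complex 0 1} = E ` {1, 2, 3, 4}"
    using E_simps by auto
  ultimately show ?thesis by auto
qed

lemma MC_R: "MC (R z) = R (MC z)"
  by (simp add: MC_def R_def algebra_simps)

lemma MC_P1: "MC (P \<theta> 1) = P' \<theta> 1"
proof -
  have "s * s + t * t = t" using st by (simp add: power2_eq_square)
  then show ?thesis
    unfolding MC_def P_simps P'_simps Zc_def complex_eq_iff
    by (simp, simp add: algebra_simps; linarith)
qed

lemma MC_P: "MC (P \<theta> i) = P' \<theta> i"
proof -
  have "MC (P \<theta> (Suc i)) = P' \<theta> (Suc i)" for i
    using MC_P1 by (induction i) (simp_all add: P_Suc[of \<theta> "Suc _"] P'_Suc[of \<theta> "Suc _"] MC_R)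
  \<comment> \<open>The induction starts at index 1, so index 0 is reached as index 4.\<close>
  from this[of "i + 3"] show ?thesis
    using cyclic_mod4[of "P \<theta>" i "Suc (i + 3)"] cyclic_mod4[of "P' \<theta>" i "Suc (i + 3)"] P_Suc P'_Suc
    by simp
qed

lemma P_notin_range_E: "P \<theta> i \<notin> range E"
proof -
  have "P \<theta> 0 \<notin> range E" using t_pos t_less_s s_less by (simp add: P_simps range_E)
  moreover have "P \<theta> i \<in> range E" if "P \<theta> (Suc i) \<in> range E" for i
  proof -
    from that obtain j where "R (P \<theta> i) = E j" by (auto simp: P_Suc)
    then have "P \<theta> i = (R ^^ 3) (E j)" by (metis R_power4 funpow_simps_right(2) numeral_3_eq_3 comp_apply funpow_0)
    also have "\<dots> = E (3 + j)" using cyclic_add[of E 3 j] E_Suc by simp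
    finally show ?thesis by auto
  qed
  ultimately show ?thesis by (induction i) blast+
qed

lemma target_E [simp]: "target (E i) = E i"
  by (simp add: target_def)

lemma target_P [simp]: "target (P \<theta> i) = P' \<theta> i"
  using P_notin_range_E by (simp add: target_def MC_P)

lemma target_R: "target (R v) = R (target v)"
proof -
  have "R v \<in> range E \<longleftrightarrow> v \<in> range E"
    by (auto simp: range_E complex_eq_iff)
  then show ?thesis by (simp add: target_def MC_R)
qed

lemma verts_Suc: "verts k (Suc i) = R ` verts k i"
  using P_Suc[of \<theta> "i + 3"] by (simp add: verts_def E_Suc P_Suc add.commute)

lemma verts_cong: "i mod 4 = j mod 4 \<Longrightarrow> verts k i = verts k j"
proof -
  assume ij: "i mod 4 = j mod 4"
  have "E (i + n) = E (j + n)" "P \<theta> (i + n) = P \<theta> (j + n)" for n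
    using cyclic_mod4[of E] cyclic_mod4[of "P \<theta>"] E_Suc P_Suc mod_add_cong[OF ij refl] by blast+
  from this this[of 0] show ?thesis by (simp only: verts_def add_0_right)
qed

lemma finite_verts [simp]: "finite (verts k i)"
  by (simp add: verts_def)

lemma hull_R: "convex hull (R ` V) = R ` (convex hull V)"
proof -
  have "R ` X = (\<lambda>x. Zc - \<i> * Zc + x) ` ((*) \<i> ` X)" for X
    by (auto simp: R_def algebra_simps image_image)
  moreover have "linear ((*) \<i>)" by (simp add: linear_times)
  ultimately show ?thesis
    by (simp add: convex_hull_translation convex_hull_linear_image)
qed

lemma hull_verts_R: "z \<in> convex hull verts k i \<Longrightarrow> (R ^^ n) z \<in> convex hull verts k (n + i)"
  by (induction n) (auto simp: verts_Suc hull_R)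

lemma linear_Complex: "linear (\<lambda>z. Complex (a * Re z + b * Im z) (c * Re z + d * Im z))"
  by (rule linearI) (auto simp: complex_eq_iff algebra_simps)

lemma linear_MB: "linear MB"
  unfolding MB_def[abs_def] by (rule linear_Complex)

lemma real_affine_piece_map: "real_affine (piece_map k i)"
proof -
  have "real_affine MA"
  proof -
    have "linear MA" by (rule linearI) (use t_pos in \<open>auto simp: MA_def complex_eq_iff field_simps\<close>)
    from real_affine_linear[OF this, of 0] show ?thesis by simp
  qed
  moreover have "real_affine MB"
    using real_affine_linear[OF linear_MB, of 0] by simp
  moreover have "real_affine MC"
  proof -
    have "MC = (\<lambda>z. Complex (2 * s) (1 - 2 * t) * z + (Zc - Complex (2 * s) (1 - 2 * t) * Zc))"
      by (auto simp: MC_def algebra_simps)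
    then show ?thesis using real_affine_linear[OF linear_times] by metis
  qed
  ultimately have "real_affine (piece_map0 k)" by (simp add: piece_map0_def)
  then have "real_affine (\<lambda>z. piece_map0 k ((R ^^ (3 * i + 1)) z))"
    using real_affine_compose real_affine_funpow real_affine_R by blast
  from real_affine_compose[OF real_affine_funpow[OF real_affine_R] this] show ?thesis
    by (simp add: piece_map_def[abs_def])
qed

lemma piece_map_1: "piece_map k 1 = piece_map0 k"
proof
  fix z
  have "(R ^^ (1 + 3)) w = w" "(R ^^ (3 * 1 + 1)) w = w" for w
    by (rule funpow_R_cancel, simp)+
  then show "piece_map k 1 z = piece_map0 k z" by (simp only: piece_map_def)
qed

lemma piece_map_rotate: "piece_map k (n + i) ((R ^^ n) z) = (R ^^ n) (piece_map k i z)"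
proof -
  have "(R ^^ (3 * (n + i) + 1)) ((R ^^ n) z) = (R ^^ (4 * n)) ((R ^^ (3 * i + 1)) z)"
    by (simp only: comp_apply[symmetric, of "R ^^ _" "R ^^ _"] funpow_add[symmetric]) (simp add: algebra_simps)
  also have "\<dots> = (R ^^ (3 * i + 1)) z" by (rule funpow_R_cancel) simp
  finally show ?thesis
    unfolding piece_map_def by (simp only: add.assoc funpow_add comp_apply)
qed

lemma piece_map0_verts:
  assumes "v \<in> verts k 1"
  shows "piece_map0 k v = target v"
proof -
  have t0: "t \<noteq> 0" and st0: "s - t \<noteq> 0" using t_pos t_less_s by auto
  have eq: "s * s = t - t * t" using st by (simp add: power2_eq_square)
  consider "k = 0" | "k = 1" | "k > 1" by linarith
  then show ?thesis
  proof cases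
    case 1
    have "MA (E 1) = target (E 1)" "MA (E 2) = target (E 2)" "MA (P \<theta> 1) = target (P \<theta> 1)"
      unfolding target_E target_P using t0
      by (simp_all add: MA_def E_simps P_simps P'_simps del: One_nat_def)
    then show ?thesis using assms 1 by (auto simp: verts_def piece_map0_def numeral_2_eq_2)
  next
    case 2
    \<comment> \<open>The four identities are the coordinates of the images of
      \<open>P \<theta> 1\<close> and \<open>P \<theta> 4\<close>, cleared of the denominator
      \<open>s - t\<close>.\<close>
    have e1: "(1 - s - t) * (1 - s + t) * s - t * (1 - 2 * s) * t = (1 - s) * (s - t)" using eq by algebra
    have e2: "t * (1 - 2 * s) * s + (s + t) * t * (s - t) = t * (s - t)" using eq by algebra
    have e3: "(1 - s - t) * (1 - s + t) * t - t * (1 - 2 * s) * (1 - s) = t * (s - t)" using eq by algebra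
    have e4: "t * (1 - 2 * s) * t + (s + t) * (1 - s) * (s - t) = s * (s - t)" using eq by algebra
    have "MB (E 1) = target (E 1)" "MB (P \<theta> 1) = target (P \<theta> 1)" "MB (P \<theta> 4) = target (P \<theta> 4)"
      unfolding target_E target_P
      subgoal by (simp add: MB_def E_simps del: One_nat_def)
      subgoal using st0 e1 e2 by (simp add: MB_def P_simps P'_simps complex_eq_iff divide_simps del: One_nat_def)
      subgoal using st0 e3 e4 by (simp add: MB_def P_simps P'_simps complex_eq_iff divide_simps del: One_nat_def)
      done
    then show ?thesis using assms 2 by (auto simp: verts_def piece_map0_def)
  next
    case 3
    then show ?thesis using assms MC_P target_P by (auto simp: verts_def piece_map0_def)
  qed
qed

lemma piece_map_verts:
  assumes "v \<in> verts k i"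
  shows "piece_map k i v = target v"
proof -
  have Suc: "piece_map k (Suc i) v = target v" if "v \<in> verts k (Suc i)" for i v
    using that
  proof (induction i arbitrary: v)
    case 0
    then show ?case using piece_map0_verts[of v k] piece_map_1[of k] by simp
  next
    case (Suc i)
    then obtain w where w: "w \<in> verts k (Suc i)" "v = R w" by (auto simp: verts_Suc[of k "Suc i"])
    then show ?case
      using Suc.IH[OF w(1)] piece_map_rotate[of k 1 "Suc i" w] by (simp add: target_R)
  qed
  have "(i + 4) mod 4 = i mod 4" by simp
  then have "v \<in> verts k (Suc (i + 3))" using assms verts_cong[of "i + 4" i k] by (simp add: add.commute)
  then have "piece_map k (4 + i) v = target v" using Suc[of v "i + 3"] by (simp add: add.commute)
  moreover have "piece_map k (4 + i) v = piece_map k i v"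
    using piece_map_rotate[of k 4 i v] funpow_R_cancel[of 4] by simp
  ultimately show ?thesis by simp
qed

section \<open>Agreement of the affine formulas on overlaps\<close>

lemma s_square: "s * s = t - t * t"
  using st by (simp add: power2_eq_square)

lemma verts_simps:
  "verts 0 1 = {Complex 0 0, Complex 1 0, Complex s t}"
  "verts 0 2 = {Complex 1 0, Complex 1 1, Complex (1 - t) s}"
  "verts 0 3 = {Complex 1 1, Complex 0 1, Complex (1 - s) (1 - t)}"
  "verts 0 4 = {Complex 0 1, Complex 0 0, Complex t (1 - s)}"
  "verts 1 1 = {Complex 0 0, Complex s t, Complex t (1 - s)}"
  "verts 1 2 = {Complex 1 0, Complex (1 - t) s, Complex s t}"
  "verts 1 3 = {Complex 1 1, Complex (1 - s) (1 - t), Complex (1 - t) s}"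
  "verts 1 4 = {Complex 0 1, Complex t (1 - s), Complex (1 - s) (1 - t)}"
  "verts 2 1 = {Complex s t, Complex (1 - t) s, Complex (1 - s) (1 - t), Complex t (1 - s)}"
  by (simp_all add: verts_def E_def P_def s_def t_def)

lemma verts_C: "verts 2 i = verts 2 1"
proof -
  have "verts 2 2 = verts 2 1" "verts 2 3 = verts 2 1" "verts 2 4 = verts 2 1"
    by (auto simp add: verts_def P_def s_def t_def)
  moreover have "verts 2 i = verts 2 ((i + 3) mod 4 + 1)"
    by (rule verts_cong) presburger
  moreover have "(i + 3) mod 4 + 1 = 1 \<or> (i + 3) mod 4 + 1 = 2 \<or> (i + 3) mod 4 + 1 = 3 \<or> (i + 3) mod 4 + 1 = 4"
    using mod4_cases[of "i + 3"] by linarith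
  ultimately show ?thesis by metis
qed

text \<open>\<open>MC\<close> commutes with \<open>R\<close>, and the two conjugating exponents add
  up to a multiple of 4.\<close>

lemma piece_map_C: "piece_map 2 i z = MC z"
proof -
  have "MC ((R ^^ n) z) = (R ^^ n) (MC z)" for n z
    by (induction n) (auto simp: MC_R)
  from this[of "3 * i + 1" z] have "piece_map 2 i z = (R ^^ (i + 3)) ((R ^^ (3 * i + 1)) (MC z))"
    by (simp add: piece_map_def piece_map0_def del: funpow.simps)
  also have "\<dots> = (R ^^ (4 * i + 4)) (MC z)"
    by (simp only: comp_apply[symmetric, of "R ^^ _" "R ^^ _"] funpow_add[symmetric])
      (simp add: algebra_simps numeral_eq_Suc)
  also have "\<dots> = MC z" by (rule funpow_R_cancel) presburger
  finally show ?thesis .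
qed

text \<open>By the last assumption the vertices on the separating line belong to both pieces, and at
  a common vertex both formulas take the value \<open>target\<close>.\<close>

lemma piece_map_eq_if_separated:
  assumes "z \<in> convex hull verts k i" "z \<in> convex hull verts k' j"
    and "\<And>v. v \<in> verts k i \<Longrightarrow> p * Re v + q * Im v + r \<ge> (0::real)"
    and "\<And>v. v \<in> verts k' j \<Longrightarrow> p * Re v + q * Im v + r \<le> 0"
    and "\<And>v. v \<in> verts k i \<Longrightarrow> p * Re v + q * Im v + r = 0 \<Longrightarrow> v \<in> verts k' j"
  shows "piece_map k i z = piece_map k' j z"
  by (rule real_affine_eq_on_separated_hulls[OF real_affine_piece_map real_affine_piece_map
        finite_verts assms(3,4) _ assms(1,2)])
    (use assms(5) piece_map_verts in auto)

lemma piece_map_agree_base: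
  assumes z: "z \<in> convex hull verts k 1" "z \<in> convex hull verts k' j"
    and k: "k \<le> k'" "k' \<le> 2" and j: "j \<in> {1, 2, 3, 4}"
  shows "piece_map k 1 z = piece_map k' j z"
proof -
  note facts = t_pos t_less_s s_less s_square
  consider "k = 0" "k' = 0" "j = 1" | "k = 0" "k' = 0" "j = 2" | "k = 0" "k' = 0" "j = 3"
    | "k = 0" "k' = 0" "j = 4" | "k = 0" "k' = 1" "j = 1" | "k = 0" "k' = 1" "j = 2"
    | "k = 0" "k' = 1" "j = 3" | "k = 0" "k' = 1" "j = 4" | "k = 0" "k' = 2"
    | "k = 1" "k' = 1" "j = 1" | "k = 1" "k' = 1" "j = 2" | "k = 1" "k' = 1" "j = 3"
    | "k = 1" "k' = 1" "j = 4" | "k = 1" "k' = 2" | "k = 2" "k' = 2"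
  proof -
    from k have "k = 0 \<or> k = 1 \<or> k = 2" "k' = 0 \<or> k' = 1 \<or> k' = 2" by auto
    moreover from j have "j = 1 \<or> j = 2 \<or> j = 3 \<or> j = 4" by simp
    ultimately show thesis using that k(1) by (elim disjE) (simp_all add: numeral_2_eq_2)
  qed
  \<comment> \<open>In cases 5, 6 and 14 the separating line carries the common edge; in cases 2, 4,
    9, 11 and 13 it passes through the only common vertex; in cases 3, 7, 8 and 12 the pieces are
    disjoint and it runs strictly between them. In the other cases both formulas are the
    same.\<close>
  then show ?thesis
  proof cases
    case 2
    show ?thesis
      by (rule piece_map_eq_if_separated[OF z, of "- s" "- t" s]; unfold 2 verts_simps)
        (insert facts, auto simp: algebra_simps)
  next
    case 3
    show ?thesis
      by (rule piece_map_eq_if_separated[OF z, of 0 "- 1" "1/2"]; unfold 3 verts_simps)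
        (insert facts, auto simp: algebra_simps)
  next
    case 4
    show ?thesis
      by (rule piece_map_eq_if_separated[OF z, of 1 "- 1" 0]; unfold 4 verts_simps)
        (insert facts, auto simp: algebra_simps)
  next
    case 5
    show ?thesis
      by (rule piece_map_eq_if_separated[OF z, of t "- s" 0]; unfold 5 verts_simps)
        (insert facts, auto simp: algebra_simps)
  next
    case 6
    show ?thesis
      by (rule piece_map_eq_if_separated[OF z, of "- t" "- (1 - s)" t]; unfold 6 verts_simps)
        (insert facts, auto simp: algebra_simps)
  next
    case 7
    show ?thesis
      by (rule piece_map_eq_if_separated[OF z, of 0 "- 1" "(s + t) / 2"]; unfold 7 verts_simps)
        (insert facts, auto simp: algebra_simps)
  next
    case 8
    show ?thesis
      by (rule piece_map_eq_if_separated[OF z, of 0 "- 1" "1/2"]; unfold 8 verts_simps)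
        (insert facts, auto simp: algebra_simps)
  next
    case 9
    show ?thesis
      by (rule piece_map_eq_if_separated[OF z, of 0 "- 1" t]; unfold 9 verts_C[of j] verts_simps)
        (insert facts, auto simp: algebra_simps)
  next
    case 11
    show ?thesis
      by (rule piece_map_eq_if_separated[OF z, of "- 1" 0 s]; unfold 11 verts_simps)
        (insert facts, (elim insertE emptyE; simp add: algebra_simps)+)
  next
    case 12
    show ?thesis
      by (rule piece_map_eq_if_separated[OF z, of "- 1" "- 1" 1]; unfold 12 verts_simps)
        (insert facts, auto simp: algebra_simps)
  next
    case 13
    show ?thesis
      by (rule piece_map_eq_if_separated[OF z, of 0 "- 1" "1 - s"]; unfold 13 verts_simps)
        (insert facts, auto simp: algebra_simps)
  next
    case 14
    show ?thesis
      by (rule piece_map_eq_if_separated[OF z, of "- s" "- t" t]; unfold 14 verts_C[of j] verts_simps)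
        (insert facts, auto simp: algebra_simps)
  next
    case 15
    show ?thesis unfolding 15 piece_map_C ..
  next
    case 1
    show ?thesis unfolding 1 ..
  next
    case 10
    show ?thesis unfolding 10 ..
  qed
qed

lemma piece_map_cong: "i mod 4 = j mod 4 \<Longrightarrow> piece_map k i = piece_map k j"
proof -
  assume ij: "i mod 4 = j mod 4"
  note mod_add_cong[OF ij refl, of 3] mod_add_cong[OF mod_mult_cong[OF refl ij] refl, of 3 1]
  then have "(R ^^ (i + 3)) z = (R ^^ (j + 3)) z" "(R ^^ (3 * i + 1)) z = (R ^^ (3 * j + 1)) z" for z
    using funpow_R_mod4[of "i + 3" z] funpow_R_mod4[of "j + 3" z]
      funpow_R_mod4[of "3 * i + 1" z] funpow_R_mod4[of "3 * j + 1" z] by presburger+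
  then show ?thesis unfolding piece_map_def[abs_def] by presburger
qed

lemma inj_funpow_R: "inj (R ^^ n)"
  by (rule inj_fn) (simp add: inj_def complex_eq_iff)

lemma piece_map_agree_le:
  assumes z: "z \<in> convex hull verts k i" "z \<in> convex hull verts k' j" and k: "k \<le> k'" "k' \<le> 2"
  shows "piece_map k i z = piece_map k' j z"
proof -
  \<comment> \<open>\<open>R ^^ n\<close> moves index \<open>i\<close> to \<open>4 * i + 1\<close>,
    that is to 1 modulo 4; \<open>j'\<close> is the representative of \<open>n + j\<close> in
    \<open>{1, 2, 3, 4}\<close>.\<close>
  define n where "n = 3 * i + 1"
  define j' where "j' = (n + j + 3) mod 4 + 1"
  have i1: "(n + i) mod 4 = 1 mod 4" and jj: "(n + j) mod 4 = j' mod 4"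
    by (simp add: n_def mod_Suc) (unfold j'_def, presburger)
  have j': "j' \<in> {1, 2, 3, 4}" using mod4_cases[of "n + j + 3"] by (auto simp: j'_def)
  have "(R ^^ n) z \<in> convex hull verts k 1" "(R ^^ n) z \<in> convex hull verts k' j'"
    using hull_verts_R[OF z(1), of n] hull_verts_R[OF z(2), of n] verts_cong[OF i1] verts_cong[OF jj]
    by auto
  from piece_map_agree_base[OF this k j']
  have "piece_map k (n + i) ((R ^^ n) z) = piece_map k' (n + j) ((R ^^ n) z)"
    using piece_map_cong[OF i1] piece_map_cong[OF jj] by simp
  then show ?thesis
    unfolding piece_map_rotate using inj_funpow_R by (simp add: inj_eq)
qed

lemma piece_map_agree:
  assumes "z \<in> convex hull verts k i" "z \<in> convex hull verts k' j" "k \<le> 2" "k' \<le> 2"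
  shows "piece_map k i z = piece_map k' j z"
  using piece_map_agree_le[of z k i k' j] piece_map_agree_le[of z k' j k i] assms linear[of k k'] by auto

end

section \<open>The map F\<close>

lemma convex_Sq: "convex Sq"
proof -
  have "Sq = {z. inner 1 z \<ge> 0} \<inter> {z. inner 1 z \<le> 1} \<inter> {z. inner \<i> z \<ge> 0} \<inter> {z. inner \<i> z \<le> 1}"
    by (auto simp: Sq_def inner_complex_def)
  then show ?thesis
    by (metis convex_Int convex_halfspace_ge convex_halfspace_le)
qed

section \<open>Covering of the square and identification of \<open>F\<close>\<close>

context pinwheel
begin

text \<open>Nonnegative on the left of the ray from \<open>E 1\<close> through
  \<open>P \<theta> 1\<close>, the side containing the centre. Evaluated at \<open>R z\<close>,
  \<open>R (R z)\<close> and \<open>R (R (R z))\<close> it tests the rays from \<open>E 4\<close>,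
  \<open>E 3\<close> and \<open>E 2\<close>.\<close>

definition level :: "complex \<Rightarrow> real" where
  "level z = s * Im z - t * Re z"

lemma center_square_cover:
  assumes "level z \<ge> 0" "level (R z) \<ge> 0" "level (R (R z)) \<ge> 0" "level (R (R (R z))) \<ge> 0"
  shows "z \<in> convex hull verts 2 1"
proof -
  define x y where "x = Re z" and "y = Im z"
  \<comment> \<open>Coordinates of the point along the sides of the central square from
    \<open>P \<theta> 1\<close> to \<open>P \<theta> 2\<close> and to \<open>P \<theta> 4\<close>;
    \<open>w\<close> is the squared side length. The four sides lie on the four rays, so each bound
    on a coordinate is one of the four level conditions up to a positive factor.\<close>
  define w \<alpha> \<beta> where "w = 1 - 2 * s"
    and "\<alpha> = ((x - s) * (1 - s - t) + (y - t) * (s - t)) / w"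
    and "\<beta> = ((y - t) * (1 - s - t) - (x - s) * (s - t)) / w"
  have pos: "w > 0" "s > 0" "1 - s - t > 0" using t_pos t_less_s s_less by (auto simp: w_def)
  have l: "s * y - t * x \<ge> 0" "s * x - t * (1 - y) \<ge> 0"
     "s * (1 - y) - t * (1 - x) \<ge> 0" "s * (1 - x) - t * y \<ge> 0"
    using assms by (simp_all add: level_def x_def y_def)
  have wab: "w * \<alpha> = (x - s) * (1 - s - t) + (y - t) * (s - t)"
    "w * \<beta> = (y - t) * (1 - s - t) - (x - s) * (s - t)"
    using pos by (simp_all add: \<alpha>_def \<beta>_def)
  have "s * w * \<alpha> = (1 - s - t) * (s * x - t * (1 - y))" "s * w * (1 - \<alpha>) = (1 - s - t) * (s * (1 - x) - t * y)"
    "s * w * \<beta> = (1 - s - t) * (s * y - t * x)" "s * w * (1 - \<beta>) = (1 - s - t) * (s * (1 - y) - t * (1 - x))"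
    using wab s_square w_def by algebra+
  then have "0 \<le> s * w * \<alpha>" "0 \<le> s * w * (1 - \<alpha>)" "0 \<le> s * w * \<beta>" "0 \<le> s * w * (1 - \<beta>)"
    using l pos by simp_all
  then have ab: "0 \<le> \<alpha>" "\<alpha> \<le> 1" "0 \<le> \<beta>" "\<beta> \<le> 1"
    using mult_pos_pos[OF pos(2,1)] by (simp_all add: zero_le_mult_iff)
  let ?H = "convex hull verts 2 1"
  have "Complex s t \<in> ?H" "Complex (1 - t) s \<in> ?H" "Complex (1 - s) (1 - t) \<in> ?H" "Complex t (1 - s) \<in> ?H"
    by (auto intro!: hull_inc simp: verts_simps simp del: One_nat_def)
  then have "(1 - \<beta>) *\<^sub>R ((1 - \<alpha>) *\<^sub>R Complex s t + \<alpha> *\<^sub>R Complex (1 - t) s)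
      + \<beta> *\<^sub>R ((1 - \<alpha>) *\<^sub>R Complex t (1 - s) + \<alpha> *\<^sub>R Complex (1 - s) (1 - t)) \<in> ?H"
    using ab by (intro convexD_alt convex_convex_hull)
  moreover have "z = (1 - \<beta>) *\<^sub>R ((1 - \<alpha>) *\<^sub>R Complex s t + \<alpha> *\<^sub>R Complex (1 - t) s)
      + \<beta> *\<^sub>R ((1 - \<alpha>) *\<^sub>R Complex t (1 - s) + \<alpha> *\<^sub>R Complex (1 - s) (1 - t))"
  proof -
    have "w * (\<alpha> * (1 - s - t) - \<beta> * (s - t)) = w * (x - s)" "w * (\<alpha> * (s - t) + \<beta> * (1 - s - t)) = w * (y - t)"
      using wab s_square w_def by algebra+
    then have "\<alpha> * (1 - s - t) - \<beta> * (s - t) = x - s" "\<alpha> * (s - t) + \<beta> * (1 - s - t) = y - t"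
      using pos by auto
    then have "x = (1 - \<beta>) * ((1 - \<alpha>) * s + \<alpha> * (1 - t)) + \<beta> * ((1 - \<alpha>) * t + \<alpha> * (1 - s))"
      "y = (1 - \<beta>) * ((1 - \<alpha>) * t + \<alpha> * s) + \<beta> * ((1 - \<alpha>) * (1 - s) + \<alpha> * (1 - t))"
      by algebra+
    then show ?thesis by (simp add: complex_eq_iff x_def y_def)
  qed
  ultimately show ?thesis by metis
qed

text \<open>The region to the right of the first ray and to the left of the second consists of
  \<A>_1 and \<B>_2, divided by the segment from \<open>E 2\<close> to \<open>P \<theta> 1\<close>.
  The case distinction asks on which side of it the point lies; the coefficients are barycentric
  coordinates.\<close>

lemma corner_triangle_cover:
  assumes "z \<in> Sq" "level z \<le> 0" "level (R (R (R z))) \<ge> 0"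
  shows "z \<in> convex hull verts 0 1 \<or> z \<in> convex hull verts 1 2"
proof -
  define x y where "x = Re z" and "y = Im z"
  have l: "s * y - t * x \<le> 0" "s * (1 - x) - t * y \<ge> 0" "y \<ge> 0"
    using assms by (simp_all add: level_def x_def y_def Sq_def)
  have z: "z = Complex x y" by (simp add: x_def y_def)
  show ?thesis
  proof (cases "t * (1 - x) \<ge> (1 - s) * y")
    case True
    have "z = (1 - (x - y * s / t) - y / t) *\<^sub>R Complex 0 0 + (x - y * s / t) *\<^sub>R Complex 1 0 + (y / t) *\<^sub>R Complex s t"
      using t_pos by (simp add: z complex_eq_iff)
    moreover have "0 \<le> y / t" "0 \<le> x - y * s / t" "0 \<le> 1 - (x - y * s / t) - y / t"
    proof -
      have "x - y * s / t = (t * x - s * y) / t" "1 - (x - y * s / t) - y / t = (t * (1 - x) - (1 - s) * y) / t"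
        using t_pos by (simp_all add: divide_simps) (simp_all add: algebra_simps)
      then show "0 \<le> y / t" "0 \<le> x - y * s / t" "0 \<le> 1 - (x - y * s / t) - y / t"
        using t_pos l True by simp_all
    qed
    ultimately have "z \<in> convex hull verts 0 1"
      unfolding verts_simps convex_hull_3 by (auto intro!: exI)
    then show ?thesis ..
  next
    case False
    define \<alpha> \<beta> where "\<alpha> = ((1 - s) * y - t * (1 - x)) / (s - t)" and "\<beta> = (s * (1 - x) - t * y) / (s - t)"
    have d: "s - t > 0" using t_less_s by simp
    have ab: "(s - t) * \<alpha> = (1 - s) * y - t * (1 - x)" "(s - t) * \<beta> = s * (1 - x) - t * y"
      using d by (simp_all add: \<alpha>_def \<beta>_def)
    have "0 \<le> \<alpha>" "0 \<le> \<beta>" using False l d by (simp_all add: \<alpha>_def \<beta>_def)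
    moreover have "0 \<le> 1 - \<alpha> - \<beta>"
    proof -
      have "s * ((s - t) * (1 - \<alpha> - \<beta>)) = (1 - s - t) * (t * x - s * y)"
        using ab s_square by algebra
      moreover have "0 \<le> (1 - s - t) * (t * x - s * y)" using l t_less_s s_less t_pos by simp
      ultimately have "0 \<le> s * ((s - t) * (1 - \<alpha> - \<beta>))" by simp
      then show ?thesis using d t_pos t_less_s by (simp add: zero_le_mult_iff)
    qed
    moreover have "z = (1 - \<alpha> - \<beta>) *\<^sub>R Complex 1 0 + \<alpha> *\<^sub>R Complex (1 - t) s + \<beta> *\<^sub>R Complex s t"
    proof -
      have "(s - t) * x = (s - t) * ((1 - \<alpha> - \<beta>) + \<alpha> * (1 - t) + \<beta> * s)" "(s - t) * y = (s - t) * (\<alpha> * s + \<beta> * t)"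
        using ab s_square by algebra+
      then have "x = (1 - \<alpha> - \<beta>) + \<alpha> * (1 - t) + \<beta> * s" "y = \<alpha> * s + \<beta> * t"
        using d by auto
      then show ?thesis by (simp add: z complex_eq_iff)
    qed
    ultimately have "z \<in> convex hull verts 1 2"
      unfolding verts_simps convex_hull_3 by (auto intro!: exI)
    then show ?thesis ..
  qed
qed

text \<open>If one level is negative and the cyclically next one is not, a rotated copy of
  \<open>corner_triangle_cover\<close> applies. Otherwise a negative level would spread around the
  cycle and make all four negative, although their sum is \<open>2 * (s - t) > 0\<close>; so all are
  nonnegative and the point is in the central square.\<close>

lemma pieces_cover:
  assumes "z \<in> Sq"
  shows "\<exists>k\<le>2. \<exists>i. z \<in> convex hull verts k i"
proof -
  have tri: ?thesis if "level ((R ^^ n) z) < 0" "level ((R ^^ (n + 3)) z) \<ge> 0" for n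
  proof -
    have "(R ^^ n) z \<in> Sq" using assms by (induction n) auto
    moreover have "(R ^^ (n + 3)) z = R (R (R ((R ^^ n) z)))" by (simp add: numeral_3_eq_3)
    ultimately have "\<exists>k\<le>2. \<exists>i. (R ^^ n) z \<in> convex hull verts k i"
      using corner_triangle_cover[of "(R ^^ n) z"] that by (metis less_eq_real_def nat_le_linear not_one_le_zero one_le_numeral zero_le)
    then obtain k i where k: "k \<le> 2" and "(R ^^ n) z \<in> convex hull verts k i" by blast
    then have "(R ^^ (3 * n)) ((R ^^ n) z) \<in> convex hull verts k (3 * n + i)"
      using hull_verts_R by blast
    moreover have "(R ^^ (3 * n)) ((R ^^ n) z) = z"
      using funpow_R_cancel[of "3 * n + n" z] by (simp only: funpow_add comp_apply) simp
    ultimately show ?thesis using k by metis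
  qed
  have 4: "level ((R ^^ (n + 4)) z) = level ((R ^^ n) z)" for n
    using funpow_R_mod4[of "n + 4"] funpow_R_mod4[of n] by simp
  have "level ((R ^^ 0) z) + level ((R ^^ 1) z) + level ((R ^^ 2) z) + level ((R ^^ 3) z) = 2 * (s - t)"
    by (simp add: level_def numeral_2_eq_2 numeral_3_eq_3 algebra_simps)
  then have sum: "level ((R ^^ 0) z) + level ((R ^^ 1) z) + level ((R ^^ 2) z) + level ((R ^^ 3) z) > 0"
    using t_less_s by simp
  show ?thesis
  proof (cases "\<exists>n. level ((R ^^ n) z) < 0 \<and> level ((R ^^ (n + 3)) z) \<ge> 0")
    case True
    then show ?thesis using tri by blast
  next
    case False
    then have neg: "level ((R ^^ (n + 3)) z) < 0" if "level ((R ^^ n) z) < 0" for n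
      using that by force
    have 1: "level ((R ^^ 3) z) < 0" if "level ((R ^^ 0) z) < 0" using neg[of 0] that by simp
    have 2: "level ((R ^^ 2) z) < 0" if "level ((R ^^ 3) z) < 0" using neg[of 3] 4[of 2] that by simp
    have 3: "level ((R ^^ 1) z) < 0" if "level ((R ^^ 2) z) < 0" using neg[of 2] 4[of 1] that by simp
    have 5: "level ((R ^^ 0) z) < 0" if "level ((R ^^ 1) z) < 0" using neg[of 1] 4[of 0] that by simp
    have "level ((R ^^ 0) z) \<ge> 0 \<and> level ((R ^^ 1) z) \<ge> 0 \<and> level ((R ^^ 2) z) \<ge> 0 \<and> level ((R ^^ 3) z) \<ge> 0"
      using 1 2 3 5 sum by linarith
    then have "z \<in> convex hull verts 2 1"
      using center_square_cover[of z] by (simp add: numeral_2_eq_2 numeral_3_eq_3)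
    then show ?thesis by blast
  qed
qed

lemma vertices_in_Sq: "E i \<in> Sq" "P \<theta> i \<in> Sq" "P' \<theta> i \<in> Sq"
proof -
  have "E 0 \<in> Sq" "P \<theta> 0 \<in> Sq" "P' \<theta> 0 \<in> Sq"
    using t_pos t_less_s s_less by (simp_all add: Sq_def E_simps P_simps P'_simps)
  then show "E i \<in> Sq" "P \<theta> i \<in> Sq" "P' \<theta> i \<in> Sq"
    by (induction i) (auto simp: E_Suc P_Suc P'_Suc)
qed

lemma verts_subset: "verts k i \<subseteq> range E \<union> range (P \<theta>)"
  by (simp add: verts_def)

lemma hull_verts_subset_Sq: "convex hull verts k i \<subseteq> Sq"
  using vertices_in_Sq verts_subset by (intro hull_minimal convex_Sq) blast

lemma piece_map_in_Sq:
  assumes "z \<in> convex hull verts k i"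
  shows "piece_map k i z \<in> Sq"
proof -
  obtain u where u: "\<And>v. v \<in> verts k i \<Longrightarrow> u v \<ge> 0" "sum u (verts k i) = 1" "(\<Sum>v\<in>verts k i. u v *\<^sub>R v) = z"
    using assms by (auto simp: convex_hull_finite)
  then have "piece_map k i z = (\<Sum>v\<in>verts k i. u v *\<^sub>R piece_map k i v)"
    using real_affine_sum[OF real_affine_piece_map] by auto
  also have "\<dots> \<in> Sq"
  proof (intro convex_sum convex_Sq u)
    fix v assume v: "v \<in> verts k i"
    then have "target v \<in> Sq" using verts_subset vertices_in_Sq by fastforce
    then show "piece_map k i v \<in> Sq" using piece_map_verts[OF v] by simp
  qed auto
  finally show ?thesis .
qed

text \<open>The choice of the piece is harmless by \<open>piece_map_agree\<close>.\<close>

definition piecewise_map :: "complex \<Rightarrow> complex" where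
  "piecewise_map = (\<lambda>z\<in>Sq. case SOME (k, i). k \<le> 2 \<and> z \<in> convex hull verts k i of (k, i) \<Rightarrow> piece_map k i z)"

lemma piecewise_map_eq:
  assumes z: "z \<in> convex hull verts k i" "k \<le> 2"
  shows "piecewise_map z = piece_map k i z"
proof -
  obtain k' j where kj: "(SOME (k, i). k \<le> 2 \<and> z \<in> convex hull verts k i) = (k', j)" by fastforce
  have "case (k', j) of (k, i) \<Rightarrow> k \<le> 2 \<and> z \<in> convex hull verts k i"
    unfolding kj[symmetric] by (rule someI[of _ "(k, i)"]) (use z in simp)
  then have "piece_map k' j z = piece_map k i z" using piece_map_agree[of z k' j k i] z by simp
  moreover have "z \<in> Sq" using z hull_verts_subset_Sq by blast
  ultimately show ?thesis by (simp add: piecewise_map_def kj)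
qed

lemma pieces_eq_hull:
  "pieceA \<theta> i = convex hull verts 0 i" "pieceB \<theta> i = convex hull verts 1 i"
  "pieceC \<theta> = convex hull verts 2 1"
  by (simp_all add: pieceA_def pieceB_def pieceC_def verts_def numeral_eq_Suc)

lemma F_eq_piecewise_map: "F \<theta> = piecewise_map"
  unfolding F_def
proof (rule the_equality)
  have aff: "affine_map_on (convex hull verts k i) piecewise_map" if "k \<le> 2" for k i
  proof -
    obtain g c where "linear g" "piece_map k i = (\<lambda>z. g z + c)"
      using real_affine_piece_map unfolding real_affine_def by blast
    then show ?thesis
      unfolding affine_map_on_def using piecewise_map_eq[OF _ that] by metis
  qed
  have "piecewise_map v = target v" if "v \<in> verts k i" "k \<le> 2" for k i v
    using piecewise_map_eq[OF hull_inc that(2)] that piece_map_verts by simp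
  from this[of "E i" 0 i for i] this[of "P \<theta> i" 0 i for i]
  have "piecewise_map (E i) = E i \<and> piecewise_map (P \<theta> i) = P' \<theta> i" for i
    by (simp add: verts_def)
  moreover have "piecewise_map \<in> Sq \<rightarrow>\<^sub>E Sq"
  proof (rule PiE_I)
    fix z assume "z \<in> Sq"
    then obtain k i where "k \<le> 2" "z \<in> convex hull verts k i" using pieces_cover by blast
    then show "piecewise_map z \<in> Sq" using piecewise_map_eq[of z k i] piece_map_in_Sq[of z k i] by simp
  qed (simp add: piecewise_map_def)
  ultimately show "piecewise_map \<in> Sq \<rightarrow>\<^sub>E Sq \<and>
     (\<forall>i. piecewise_map (E i) = E i \<and> piecewise_map (P \<theta> i) = P' \<theta> i) \<and>
     (\<forall>i. affine_map_on (pieceA \<theta> i) piecewise_map \<and> affine_map_on (pieceB \<theta> i) piecewise_map) \<and>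
     affine_map_on (pieceC \<theta>) piecewise_map"
    using aff by (simp add: pieces_eq_hull)
next
  \<comment> \<open>Uniqueness: on each piece the vertex values determine an affine map, and off the
    square extensionality decides.\<close>
  fix f
  assume f: "f \<in> Sq \<rightarrow>\<^sub>E Sq \<and> (\<forall>i. f (E i) = E i \<and> f (P \<theta> i) = P' \<theta> i) \<and>
     (\<forall>i. affine_map_on (pieceA \<theta> i) f \<and> affine_map_on (pieceB \<theta> i) f) \<and> affine_map_on (pieceC \<theta>) f"
  show "f = piecewise_map"
  proof
    fix z
    show "f z = piecewise_map z"
    proof (cases "z \<in> Sq")
      case True
      then obtain k i where k: "k \<le> 2" and z: "z \<in> convex hull verts k i" using pieces_cover by blast
      have "affine_map_on (convex hull verts k i) f"
      proof -
        consider "k = 0" | "k = 1" | "k = 2" using k by linarith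
        then show ?thesis
          by cases (use f verts_C[of i] in \<open>simp_all add: pieces_eq_hull\<close>)
      qed
      moreover have "f v = piece_map k i v" if "v \<in> verts k i" for v
      proof -
        have "v \<in> range E \<union> range (P \<theta>)" using that verts_subset by blast
        then have "f v = target v" using f by auto
        then show ?thesis using piece_map_verts[OF that] by simp
      qed
      ultimately have "f z = piece_map k i z"
        using affine_map_on_hull_eq[OF _ real_affine_piece_map finite_verts] z by blast
      then show ?thesis using piecewise_map_eq z k by simp
    next
      case False
      then show ?thesis using f by (auto simp: piecewise_map_def PiE_def extensional_def)
    qed
  qed
qed

lemma F_eq_piece_map: "z \<in> convex hull verts k i \<Longrightarrow> k \<le> 2 \<Longrightarrow> F \<theta> z = piece_map k i z"
  using piecewise_map_eq by (simp add: F_eq_piecewise_map)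

lemma F_R: "z \<in> Sq \<Longrightarrow> F \<theta> (R z) = R (F \<theta> z)"
proof -
  assume "z \<in> Sq"
  then obtain k i where k: "k \<le> 2" and z: "z \<in> convex hull verts k i" using pieces_cover by blast
  from z have "R z \<in> convex hull verts k (1 + i)" using hull_verts_R[of z k i 1] by simp
  then show ?thesis
    using F_eq_piece_map k z piece_map_rotate[of k 1 i z] by simp
qed

end

section \<open>Star-shaped polygons with fourfold symmetry\<close>

text \<open>Signed area: positive exactly when \<open>b\<close> lies counterclockwise from
  \<open>a\<close> by an angle strictly between 0 and pi.\<close>

definition cross :: "complex \<Rightarrow> complex \<Rightarrow> real" where
  "cross a b = Im (cnj a * b)"

lemma cross_simps [simp]: "cross a b = Re a * Im b - Im a * Re b"
  by (simp add: cross_def)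

text \<open>The half-open quadrant is a fundamental domain for multiplication by \<i> off the
  origin.\<close>

lemma i_power_quadrant_unique:
  assumes "\<i> ^ a * z = \<i> ^ b * w" "a < 4" "b < 4"
    and "Re z > 0" "Im z \<ge> 0" "Re w > 0" "Im w \<ge> 0"
  shows "a = b"
proof -
  have "a \<in> {0, 1, 2, 3}" "b \<in> {0, 1, 2, 3}" using assms by auto
  then show ?thesis using assms(1,4-)
    by (auto simp: complex_eq_iff numeral_3_eq_3)
qed

text \<open>One quarter of the vertices determines the polygon. Positivity for all pairs, the end
  \<open>l\<close> included, says that the angle seen from the centre increases strictly from
  \<open>V 0\<close> up to \<open>V l\<close>, which is \<open>V 0\<close> turned by a right
  angle.\<close>

locale star_polygon =
  fixes V :: "nat \<Rightarrow> complex" and l :: nat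
  assumes l_pos: "l > 0"
    and V_add: "V (j + l) = R (V j)"
    and cross_pos: "j < k \<Longrightarrow> k \<le> l \<Longrightarrow> cross (V j - Zc) (V k - Zc) > 0"
begin

definition W :: "nat \<Rightarrow> complex" where "W j = V j - Zc"

text \<open>Relative to the centre, with one unit of parameter per side, so that a map advancing the
  polygon by one side becomes translation by 1. As \<open>nat\<close> truncates, only nonnegative
  arguments are meaningful.\<close>

definition G :: "real \<Rightarrow> complex" where
  "G y = (let j = nat \<lfloor>y\<rfloor>; u = y - real j in (1 - u) *\<^sub>R W j + u *\<^sub>R W (Suc j))"

definition curve :: "real \<Rightarrow> complex" where
  "curve x = Zc + G (4 * real l * x)"

definition polygon :: "complex set" where
  "polygon = (\<Union>j. closed_segment (V j) (V (Suc j)))"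

lemma W_add: "W (j + l) = \<i> * W j"
  by (simp add: W_def V_add R_def)

lemma G_segment:
  assumes "real j \<le> y" "y \<le> real (Suc j)"
  shows "G y = (1 - (y - real j)) *\<^sub>R W j + (y - real j) *\<^sub>R W (Suc j)"
proof (cases "y = real (Suc j)")
  case True
  then have "nat \<lfloor>y\<rfloor> = Suc j" by simp
  then show ?thesis by (simp add: G_def True)
next
  case False
  then have "\<lfloor>y\<rfloor> = int j" using assms by (intro floor_unique) auto
  then show ?thesis by (simp add: G_def Let_def)
qed

lemma G_of_nat: "G (real j) = W j"
  using G_segment[of j "real j"] by simp

lemma obtain_segment:
  assumes "0 \<le> y"
  obtains j where "real j \<le> y" "y < real (Suc j)"
proof
  show "real (nat \<lfloor>y\<rfloor>) \<le> y" "y < real (Suc (nat \<lfloor>y\<rfloor>))" using assms by linarith+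
qed

lemma G_add: "0 \<le> y \<Longrightarrow> G (y + real l) = \<i> * G y"
proof -
  assume "0 \<le> y"
  then obtain j where j: "real j \<le> y" "y < real (Suc j)" by (rule obtain_segment)
  have "G (y + real l) = (1 - (y - real j)) *\<^sub>R W (j + l) + (y - real j) *\<^sub>R W (Suc j + l)"
    using G_segment[of "j + l" "y + real l"] j by simp
  then show ?thesis
    unfolding W_add using G_segment[of j y] j by (simp add: distrib_left)
qed

lemma G_add_mult: "0 \<le> y \<Longrightarrow> G (y + real (a * l)) = \<i> ^ a * G y"
proof (induction a)
  case (Suc a)
  then show ?case using G_add[of "y + real (a * l)"] by (simp add: algebra_simps)
qed simp

lemma G_periodic: "0 \<le> y \<Longrightarrow> G (y + 4 * real l) = G y"
  using G_add_mult[of y 4] by (simp add: numeral_eq_Suc)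

text \<open>\<open>cross\<close> is bilinear, so between points on two sides it is a combination of
  the vertex values with nonnegative weights; the term with weight \<open>(1 - u) * v\<close> keeps
  it strict.\<close>

lemma cross_G_pos:
  assumes "0 \<le> x" "x < y" "y \<le> real l"
  shows "cross (G x) (G y) > 0"
proof -
  obtain j where j: "real j \<le> x" "x < real (Suc j)" using assms(1) by (rule obtain_segment)
  \<comment> \<open>The value \<open>y = l\<close> is allowed, so \<open>y\<close> is put on a side
    that is half-open on the left; this guarantees \<open>Suc k \<le> l\<close>.\<close>
  define k where "k = nat (\<lceil>y\<rceil> - 1)"
  have k: "real k < y" "y \<le> real (Suc k)" unfolding k_def using assms by linarith+
  have kl: "Suc k \<le> l" using k assms by linarith
  define u v where "u = x - real j" and "v = y - real k"
  have u: "0 \<le> u" "u < 1" and v: "0 < v" "v \<le> 1" using j k by (auto simp: u_def v_def)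
  have Gx: "G x = (1 - u) *\<^sub>R W j + u *\<^sub>R W (Suc j)" and Gy: "G y = (1 - v) *\<^sub>R W k + v *\<^sub>R W (Suc k)"
    using G_segment[of j x] G_segment[of k y] j k by (simp_all add: u_def v_def)
  have c: "cross (W a) (W b) > 0" if "a < b" "b \<le> l" for a b
    using cross_pos[OF that] unfolding W_def .
  have "j < Suc k" using j k assms by linarith
  then consider "j = k" | "j < k" by linarith
  then show ?thesis
  proof cases
    case 1
    have "cross (G x) (G y) = (v - u) * cross (W j) (W (Suc j))"
      unfolding Gx Gy 1 by (simp add: algebra_simps)
    moreover have "v > u" using 1 assms by (simp add: u_def v_def)
    ultimately show ?thesis using c[of j "Suc j"] kl 1 by simp
  next
    case 2
    have "cross (W (Suc j)) (W k) \<ge> 0"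
      using c[of "Suc j" k] 2 kl by (cases "Suc j = k") auto
    then have "0 \<le> (1 - u) * (1 - v) * cross (W j) (W k)" "0 \<le> u * (1 - v) * cross (W (Suc j)) (W k)"
      "0 \<le> u * v * cross (W (Suc j)) (W (Suc k))"
      using u v c[of j k] c[of "Suc j" "Suc k"] 2 kl by (auto intro!: mult_nonneg_nonneg simp del: cross_simps)
    moreover have "0 < (1 - u) * v * cross (W j) (W (Suc k))"
      using u v c[of j "Suc k"] 2 kl by (intro mult_pos_pos) (auto simp del: cross_simps)
    moreover have "cross (G x) (G y) = (1 - u) * (1 - v) * cross (W j) (W k) + u * (1 - v) * cross (W (Suc j)) (W k)
        + u * v * cross (W (Suc j)) (W (Suc k)) + (1 - u) * v * cross (W j) (W (Suc k))"
      unfolding Gx Gy by (simp add: algebra_simps)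
    ultimately show ?thesis by linarith
  qed
qed

lemma W0_nonzero: "W 0 \<noteq> 0"
  using cross_pos[of 0 l] l_pos by (auto simp: W_def)

text \<open>Division by \<open>W 0\<close> turns the quarter into the first quadrant: up to a
  positive factor the imaginary part is the cross product with the initial point, and the real part
  the one with the final point \<open>\<i> * W 0\<close>.\<close>

lemma G_quadrant:
  assumes "0 \<le> x" "x \<le> real l"
  shows "Im (G x / W 0) \<ge> 0" "Re (G x / W 0) \<ge> 0" "x < real l \<Longrightarrow> Re (G x / W 0) > 0"
    "Re (G x / W 0) + Im (G x / W 0) > 0"
proof -
  have G0: "G 0 = W 0" and Gl: "G (real l) = \<i> * W 0" using G_of_nat[of 0] G_add[of 0] by auto
  define n where "n = (cmod (W 0))\<^sup>2"
  have n: "n > 0" using W0_nonzero by (simp add: n_def)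
  have im: "Im (G x / W 0) = cross (G 0) (G x) / n" and re: "Re (G x / W 0) = cross (G x) (G (real l)) / n"
    unfolding n_def G0 Gl
    by (simp_all add: complex_div_cnj[of "G x" "W 0"] algebra_simps)
  have ipos: "Im (G x / W 0) > 0" if "0 < x" using cross_G_pos[of 0 x] that assms n by (simp only: im) simp
  have i0: "Im (G x / W 0) = 0" if "x = 0" by (subst im) (simp add: that)
  show rpos: "Re (G x / W 0) > 0" if "x < real l" using cross_G_pos[of x "real l"] that assms n by (simp only: re) simp
  have r0: "Re (G x / W 0) = 0" if "x = real l" by (subst re) (simp add: that)
  show "Im (G x / W 0) \<ge> 0" using ipos i0 assms(1) by fastforce
  show "Re (G x / W 0) \<ge> 0" using rpos r0 assms(2) by fastforce
  show "Re (G x / W 0) + Im (G x / W 0) > 0"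
    using ipos i0 rpos r0 assms l_pos by (cases "x = 0"; cases "x = real l") auto
qed

lemma obtain_quarter:
  assumes "0 \<le> y" "y < 4 * real l"
  obtains a x where "a < 4" "0 \<le> x" "x < real l" "y = x + real (a * l)"
proof -
  define a where "a = nat \<lfloor>y / real l\<rfloor>"
  have l: "real l > 0" using l_pos by simp
  have a: "real a \<le> y / real l" "y / real l < real a + 1"
    unfolding a_def using assms l by (auto simp: of_nat_nat)
  have "y / real l < 4" using assms l by (simp add: field_simps)
  then have "a < 4" using a by linarith
  moreover have "0 \<le> y - real (a * l)" "y - real (a * l) < real l"
    using a l by (simp_all add: field_simps)
  ultimately show thesis using that[of a "y - real (a * l)"] by simp
qed

text \<open>The quadrant determines the quarter, and within a quarter the angle is strictly
  increasing.\<close>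

lemma G_inj:
  assumes "G y = G y'" "0 \<le> y" "y < 4 * real l" "0 \<le> y'" "y' < 4 * real l"
  shows "y = y'"
proof -
  obtain a x where a: "a < 4" "0 \<le> x" "x < real l" "y = x + real (a * l)"
    using assms(2,3) by (rule obtain_quarter)
  obtain a' x' where a': "a' < 4" "0 \<le> x'" "x' < real l" "y' = x' + real (a' * l)"
    using assms(4,5) by (rule obtain_quarter)
  have "\<i> ^ a * G x = \<i> ^ a' * G x'" using assms(1) a a' G_add_mult by metis
  then have "\<i> ^ a * (G x / W 0) = \<i> ^ a' * (G x' / W 0)" by (metis times_divide_eq_right)
  from i_power_quadrant_unique[OF this] have aa: "a = a'"
    using a a' G_quadrant[of x] G_quadrant[of x'] by (simp del: Re_divide Im_divide)
  with \<open>\<i> ^ a * G x = \<i> ^ a' * G x'\<close> have "G x = G x'" by simp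
  then have "\<not> x < x'" "\<not> x' < x"
    using cross_G_pos[of x x'] cross_G_pos[of x' x] a a' by auto
  then show ?thesis using aa a a' by simp
qed

lemma continuous_on_G: "continuous_on {0..real n} G"
proof (induction n)
  case (Suc n)
  have "continuous_on {real n..real (Suc n)} (\<lambda>y. (1 - (y - real n)) *\<^sub>R W n + (y - real n) *\<^sub>R W (Suc n))"
    by (intro continuous_intros)
  then have "continuous_on {real n..real (Suc n)} G"
    by (rule continuous_on_eq) (rule G_segment[symmetric], auto)
  with Suc have "continuous_on ({0..real n} \<union> {real n..real (Suc n)}) G"
    by (intro continuous_on_closed_Un) auto
  moreover have "{0..real n} \<union> {real n..real (Suc n)} = {0..real (Suc n)}" by auto
  ultimately show ?case by simp
qed simp

lemma curve_0_1: "curve 1 = curve 0"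
  using G_periodic[of 0] by (simp add: curve_def)

lemma path_curve: "path curve"
proof -
  have "continuous_on {0..1} (G \<circ> (\<lambda>x. 4 * real l * x))"
  proof (rule continuous_on_compose)
    show "continuous_on {0..1} (\<lambda>x. 4 * real l * x)" by (intro continuous_intros)
    have "(\<lambda>x. 4 * real l * x) ` {0..1} \<subseteq> {0..real (4 * l)}"
      using l_pos by (auto simp: mult_left_le)
    then show "continuous_on ((\<lambda>x. 4 * real l * x) ` {0..1}) G"
      using continuous_on_G continuous_on_subset by blast
  qed
  then show ?thesis unfolding path_def curve_def[abs_def] comp_def by (intro continuous_intros)
qed

lemma curve_closed: "pathfinish curve = pathstart curve"
  by (simp add: pathfinish_def pathstart_def curve_0_1)

lemma curve_inj:
  assumes "curve x = curve y" "0 \<le> x" "x < 1" "0 \<le> y" "y < 1"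
  shows "x = y"
  using G_inj[of "4 * real l * x" "4 * real l * y"] assms l_pos by (simp add: curve_def)

lemma simple_path_curve: "simple_path curve"
proof -
  have "x = y \<or> x = 0 \<and> y = 1 \<or> x = 1 \<and> y = 0"
    if xy: "0 \<le> x" "x \<le> 1" "0 \<le> y" "y \<le> 1" "curve x = curve y" for x y :: real
  proof -
    consider "x = 1" "y = 1" | "x = 1" "y < 1" | "x < 1" "y = 1" | "x < 1" "y < 1"
      using xy by (metis less_eq_real_def)
    then show ?thesis
    proof cases
      case 2
      then have "0 = y" using that curve_0_1 by (intro curve_inj) auto
      then show ?thesis using 2 by simp
    next
      case 3
      then have "x = 0" using that curve_0_1 by (intro curve_inj) auto
      then show ?thesis using 3 by simp
    next
      case 4
      then have "x = y" using that by (intro curve_inj) auto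
      then show ?thesis ..
    qed simp
  qed
  then show ?thesis unfolding simple_path_def loop_free_def using path_curve by auto
qed

lemma curve_frac_add:
  "Zc + G (4 * real l * frac x + 1) = curve (frac (x + 1 / (4 * real l)))"
proof -
  have l4: "4 * real l \<ge> 1" "real l > 0" using l_pos by linarith+
  have d: "0 \<le> 1 / (4 * real l)" "1 / (4 * real l) < 1" using l_pos by (auto simp: divide_simps)
  show ?thesis
  proof (cases "frac x + 1 / (4 * real l) < 1")
    case True
    then have "frac (x + 1 / (4 * real l)) = frac x + 1 / (4 * real l)"
      using d by (simp add: frac_add frac_eq[THEN iffD2])
    then show ?thesis using l4 by (simp add: curve_def algebra_simps)
  next
    case False
    then have "frac (x + 1 / (4 * real l)) = frac x + 1 / (4 * real l) - 1"
      using d by (simp add: frac_add frac_eq[THEN iffD2])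
    moreover have "4 * real l * (frac x + 1 / (4 * real l) - 1) = 4 * real l * frac x + 1 - 4 * real l"
      using l4 by (simp add: algebra_simps)
    moreover have "0 \<le> 4 * real l * (frac x + 1 / (4 * real l) - 1)" using False l4 by simp
    ultimately show ?thesis using G_periodic[of "4 * real l * frac x + 1 - 4 * real l"]
      by (simp add: curve_def)
  qed
qed

lemma G_image_polygon: "0 \<le> y \<Longrightarrow> Zc + G y \<in> polygon"
proof -
  assume "0 \<le> y"
  then obtain j where j: "real j \<le> y" "y < real (Suc j)" by (rule obtain_segment)
  have "Zc + G y = (1 - (y - real j)) *\<^sub>R V j + (y - real j) *\<^sub>R V (Suc j)"
    using G_segment[of j y] j by (simp add: W_def algebra_simps)
  then have "Zc + G y \<in> closed_segment (V j) (V (Suc j))"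
    using j unfolding closed_segment_def by (intro CollectI exI[of _ "y - real j"]) auto
  then show ?thesis by (auto simp: polygon_def)
qed

lemma polygon_eq_G_image: "polygon = (\<lambda>y. Zc + G y) ` {0..}"
proof
  show "polygon \<subseteq> (\<lambda>y. Zc + G y) ` {0..}"
  proof
    fix z assume "z \<in> polygon"
    then obtain j u where u: "0 \<le> u" "u \<le> 1" "z = (1 - u) *\<^sub>R V j + u *\<^sub>R V (Suc j)"
      by (auto simp: polygon_def closed_segment_def)
    then have "G (real j + u) = (1 - u) *\<^sub>R W j + u *\<^sub>R W (Suc j)"
      using G_segment[of j "real j + u"] by simp
    then have "z = Zc + G (real j + u)"
      unfolding u(3) W_def by (simp add: algebra_simps)
    then show "z \<in> (\<lambda>y. Zc + G y) ` {0..}" using u by (intro image_eqI[of _ _ "real j + u"]) auto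
  qed
qed (use G_image_polygon in auto)

lemma obtain_curve_parameter:
  assumes "0 \<le> y"
  obtains x where "0 \<le> x" "x < 1" "Zc + G y = curve x"
proof -
  have l: "real l > 0" using l_pos by simp
  define n where "n = nat \<lfloor>y / (4 * real l)\<rfloor>"
  have n: "real n = of_int \<lfloor>y / (4 * real l)\<rfloor>" using assms l by (simp add: n_def)
  define x where "x = frac (y / (4 * real l))"
  have x: "0 \<le> x" "x < 1" by (auto simp: x_def frac_lt_1)
  have "y = 4 * real l * x + real (n * 4 * l)"
    using l by (simp add: x_def frac_def n algebra_simps)
  then have "G y = \<i> ^ (n * 4) * G (4 * real l * x)"
    using G_add_mult[of "4 * real l * x" "n * 4"] x l by simp
  moreover have "\<i> ^ (n * 4) = 1"
  proof -
    have "\<i> ^ 4 = 1" by (simp add: numeral_eq_Suc)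
    then show ?thesis by (metis mult.commute power_mult power_one)
  qed
  ultimately have "G y = G (4 * real l * x)" by simp
  then show thesis using that x by (simp add: curve_def)
qed

lemma path_image_curve: "path_image curve = polygon"
proof
  show "path_image curve \<subseteq> polygon"
    using G_image_polygon by (auto simp: path_image_def curve_def)
  show "polygon \<subseteq> path_image curve"
  proof
    fix z assume "z \<in> polygon"
    then obtain y where "0 \<le> y" "z = Zc + G y" by (auto simp: polygon_eq_G_image)
    then obtain x where "0 \<le> x" "x < 1" "z = curve x" using obtain_curve_parameter by metis
    then show "z \<in> path_image curve" by (auto simp: path_image_def)
  qed
qed

text \<open>The curve is compared with the counterclockwise unit circle that starts in the direction
  of \<open>W 0\<close>. At equal times both points lie in the same closed quadrant around the
  centre, so the segment between them misses the centre and the winding numbers agree.\<close>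

lemma winding_number_curve_pos: "Zc \<notin> polygon" "Re (winding_number curve Zc) > 0"
proof -
  define c where "c = part_circlepath Zc 1 (Arg (W 0)) (Arg (W 0) + 2 * pi)"
  have c: "c x = Zc + W 0 / cmod (W 0) * exp (2 * of_real pi * of_real x * \<i>)" for x
  proof -
    have "exp (\<i> * of_real (linepath (Arg (W 0)) (Arg (W 0) + 2 * pi) x))
        = exp (\<i> * of_real (Arg (W 0))) * exp (2 * of_real pi * of_real x * \<i>)"
      by (simp add: linepath_def exp_add[symmetric] algebra_simps)
    moreover have "exp (\<i> * of_real (Arg (W 0))) = W 0 / cmod (W 0)"
      using Arg_eq[OF W0_nonzero] W0_nonzero by (metis mult.commute nonzero_eq_divide_eq norm_eq_zero of_real_eq_0_iff)
    ultimately show ?thesis by (simp add: c_def part_circlepath_def)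
  qed
  have seg: "Zc \<notin> closed_segment (curve x) (c x)" if "x \<in> {0..1}" for x
  proof -
    have main: "Zc \<notin> closed_segment (Zc + \<i> ^ a * G y) (Zc + \<i> ^ a * (W 0 / cmod (W 0) * exp (2 * of_real pi * of_real (y / (4 * real l)) * \<i>)))"
      if y: "0 \<le> y" "y \<le> real l" for y a
    proof
      define \<phi> where "\<phi> = 2 * pi * (y / (4 * real l))"
      assume "Zc \<in> closed_segment (Zc + \<i> ^ a * G y) (Zc + \<i> ^ a * (W 0 / cmod (W 0) * exp (2 * of_real pi * of_real (y / (4 * real l)) * \<i>)))"
      moreover have "exp (2 * of_real pi * of_real (y / (4 * real l)) * \<i>) = cis \<phi>"
        by (simp add: cis_conv_exp \<phi>_def algebra_simps)
      ultimately obtain u where u: "0 \<le> u" "u \<le> 1" and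
        eq: "Zc = (1 - u) *\<^sub>R (Zc + \<i> ^ a * G y) + u *\<^sub>R (Zc + \<i> ^ a * (W 0 / cmod (W 0) * cis \<phi>))"
        by (auto simp: closed_segment_def)
      have "\<i> ^ a * W 0 * ((1 - u) *\<^sub>R (G y / W 0) + (u / cmod (W 0)) *\<^sub>R cis \<phi>) = 0"
      proof -
        have "A * w * ((1 - u) *\<^sub>R q + (u / m) *\<^sub>R c)
            = (1 - u) *\<^sub>R (A * (q * w)) + u *\<^sub>R (A * (w / of_real m * c))" for A w q c :: complex and m :: real
          by (simp add: scaleR_conv_of_real algebra_simps)
        then have "\<i> ^ a * W 0 * ((1 - u) *\<^sub>R (G y / W 0) + (u / cmod (W 0)) *\<^sub>R cis \<phi>)
            = (1 - u) *\<^sub>R (\<i> ^ a * (G y / W 0 * W 0)) + u *\<^sub>R (\<i> ^ a * (W 0 / cmod (W 0) * cis \<phi>))" .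
        also have "G y / W 0 * W 0 = G y" using W0_nonzero by simp
        also have "(1 - u) *\<^sub>R (\<i> ^ a * G y) + u *\<^sub>R (\<i> ^ a * (W 0 / cmod (W 0) * cis \<phi>)) = 0"
          using eq by (simp add: scaleR_add_right scaleR_diff_left add_diff_eq diff_add_eq)
        finally show ?thesis .
      qed
      then have z: "(1 - u) *\<^sub>R (G y / W 0) + (u / cmod (W 0)) *\<^sub>R cis \<phi> = 0"
        using W0_nonzero by simp
      have "0 \<le> \<phi>" "\<phi> \<le> pi / 2" using y l_pos by (auto simp: \<phi>_def field_simps)
      then have "cos \<phi> \<ge> 0" "sin \<phi> \<ge> 0" by (auto intro!: cos_ge_zero sin_ge_zero)
      moreover have "(cos \<phi>)\<^sup>2 + (sin \<phi>)\<^sup>2 = 1" by simp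
      ultimately have cs: "cos \<phi> + sin \<phi> > 0"
        by (smt (verit) zero_eq_power2)
      \<comment> \<open>The sum of real and imaginary part is positive at both points of the
        quadrant, so no convex combination of them vanishes.\<close>
      have "(1 - u) * (Re (G y / W 0) + Im (G y / W 0)) + (u / cmod (W 0)) * (cos \<phi> + sin \<phi>) = 0"
        using arg_cong[OF z, of "\<lambda>z. Re z + Im z"] by (simp add: algebra_simps add_divide_distrib del: Re_divide Im_divide)
      moreover have "0 \<le> (1 - u) * (Re (G y / W 0) + Im (G y / W 0))" "0 \<le> (u / cmod (W 0)) * (cos \<phi> + sin \<phi>)"
        using G_quadrant(4)[OF y] cs u by (auto intro!: mult_nonneg_nonneg simp del: Re_divide Im_divide)
      ultimately have "(1 - u) * (Re (G y / W 0) + Im (G y / W 0)) = 0" "(u / cmod (W 0)) * (cos \<phi> + sin \<phi>) = 0"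
        by linarith+
      then show False using G_quadrant(4)[OF y] cs W0_nonzero by auto
    qed
    \<comment> \<open>\<open>obtain_quarter\<close> excludes the right end, so \<open>x = 1\<close>
      is treated as the end of the last quarter.\<close>
    obtain a y where ay: "0 \<le> y" "y \<le> real l" "4 * real l * x = y + real (a * l)"
    proof (cases "x = 1")
      case True
      then show thesis using that[of "real l" 3] by simp
    next
      case False
      then have "0 \<le> 4 * real l * x" "4 * real l * x < 4 * real l" using that \<open>x \<in> {0..1}\<close> l_pos by auto
      then obtain a y where "a < 4" "0 \<le> y" "y < real l" "4 * real l * x = y + real (a * l)" by (rule obtain_quarter)
      then show thesis using that[of y a] by simp
    qed
    have "x = y / (4 * real l) + real a / 4" using ay l_pos by (simp add: field_simps)
    then have "exp (2 * of_real pi * of_real x * \<i>) = exp (2 * of_real pi * of_real (y / (4 * real l)) * \<i>) * exp (of_nat a * (of_real pi / 2 * \<i>))"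
      by (simp add: exp_add[symmetric] algebra_simps add_divide_distrib)
    also have "exp (of_nat a * (of_real pi / 2 * \<i>)) = \<i> ^ a"
    proof -
      have "exp (of_real pi / 2 * \<i>) = \<i>" using cis_pi_half by (simp add: cis_conv_exp mult.commute)
      then show ?thesis by (simp only: exp_of_nat_mult)
    qed
    finally have "c x = Zc + \<i> ^ a * (W 0 / cmod (W 0) * exp (2 * of_real pi * of_real (y / (4 * real l)) * \<i>))"
      by (simp add: c mult_ac)
    moreover have "curve x = Zc + \<i> ^ a * G y"
      using ay G_add_mult by (simp add: curve_def)
    ultimately show ?thesis using main[OF ay(1,2)] by simp
  qed
  show "Zc \<notin> polygon"
    using seg unfolding path_image_curve[symmetric] path_image_def by fastforce
  have "pathfinish c = pathstart c"
    by (simp add: pathfinish_def pathstart_def c)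
  then have "winding_number c Zc = winding_number curve Zc"
    using seg path_curve curve_closed
    by (intro winding_number_loops_linear_eq) (auto simp: c_def)
  moreover have "Re (winding_number c Zc) > 0"
    unfolding c_def by (rule winding_number_part_circlepath_pos_less) auto
  ultimately show "Re (winding_number curve Zc) > 0" by simp
qed

lemma ccw_curve: "ccw_parametrization curve polygon" and center_inside: "Zc \<in> inside polygon"
proof -
  show ins: "Zc \<in> inside polygon"
  proof (rule ccontr)
    assume "Zc \<notin> inside polygon"
    then have "Zc \<in> outside (path_image curve)"
      using winding_number_curve_pos(1) inside_Un_outside[of polygon] unfolding path_image_curve by blast
    then show False
      using winding_number_zero_in_outside[OF path_curve curve_closed] winding_number_curve_pos(2) by simp
  qed
  \<comment> \<open>A simple closed path has winding number 1 at all inside points or -1 at all of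
    them; the positive real part at the centre excludes the latter.\<close>
  have "winding_number curve z = 1" if "z \<in> inside polygon" for z
    using that ins winding_number_curve_pos(2)
    by (rule_tac simple_closed_path_winding_number_inside[OF simple_path_curve]) (auto simp: path_image_curve)
  then show "ccw_parametrization curve polygon"
    unfolding ccw_parametrization_def using simple_path_curve curve_closed path_image_curve by blast
qed

end

section \<open>Dynamics on a star-shaped polygon\<close>

lemma frac_add_less_cases:
  assumes "0 \<le> x" "x < 1" "0 \<le> c" "c < 1"
  shows "frac (x + c) = (if x + c < 1 then x + c else x + c - 1)"
proof -
  have "frac x = x" "frac c = c" using assms by (simp_all add: frac_eq)
  then show ?thesis by (simp add: frac_add)
qed

lemma cyclically_ordered_rotate:
  assumes "cyclically_ordered x y z" "x \<in> {0..<1}" "y \<in> {0..<1}" "z \<in> {0..<1}" "0 \<le> c" "c < 1"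
  shows "cyclically_ordered (frac (x + c)) (frac (y + c)) (frac (z + c))"
proof -
  have "frac (x + c) = (if x + c < 1 then x + c else x + c - 1)"
    "frac (y + c) = (if y + c < 1 then y + c else y + c - 1)"
    "frac (z + c) = (if z + c < 1 then z + c else z + c - 1)"
    using assms by (simp_all add: frac_add_less_cases)
  then show ?thesis using assms unfolding cyclically_ordered_def
    by (simp split: if_split) linarith
qed

context star_polygon
begin

lemma W_add_mult: "W (j + a * l) = \<i> ^ a * W j"
proof (induction a)
  case (Suc a)
  then show ?case using W_add[of "j + a * l"] by (simp add: algebra_simps)
qed simp

lemma V_periodic: "V (j + n * (4 * l)) = V j"
proof -
  have "\<i> ^ 4 = 1" by (simp add: numeral_eq_Suc)
  then have "\<i> ^ (n * 4) = 1" by (metis mult.commute power_mult power_one)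
  then have "W (j + n * (4 * l)) = W j" using W_add_mult[of j "n * 4"] by (simp add: mult.assoc)
  then show ?thesis by (simp add: W_def)
qed

lemma V_Suc_neq: "V j \<noteq> V (Suc j)"
proof -
  define r a where "r = j mod l" and "a = j div l"
  have "j = r + a * l" "r < l" using l_pos by (simp_all add: r_def a_def)
  then have "W j = \<i> ^ a * W r" "W (Suc j) = \<i> ^ a * W (Suc r)"
    using W_add_mult[of r a] W_add_mult[of "Suc r" a] by simp_all
  moreover have "W r \<noteq> W (Suc r)"
    using cross_pos[of r "Suc r"] \<open>r < l\<close> by (auto simp: W_def)
  ultimately have "W j \<noteq> W (Suc j)" by simp
  then show ?thesis by (auto simp: W_def)
qed

lemma finite_union_polygon: "finite_union_of_segments polygon"
proof -
  define T where "T = (\<lambda>j. (V j, V (Suc j))) ` {..<4 * l}"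
  have "closed_segment (V j) (V (Suc j)) \<subseteq> (\<Union>(a, b)\<in>T. closed_segment a b)" for j
  proof -
    define r n where "r = j mod (4 * l)" and "n = j div (4 * l)"
    have "j = r + n * (4 * l)" "r < 4 * l" using l_pos by (simp_all add: r_def n_def mult.commute[of "j div _"])
    then have "V j = V r" "V (Suc j) = V (Suc r)"
      using V_periodic[of r n] V_periodic[of "Suc r" n] by simp_all
    then show ?thesis using \<open>r < 4 * l\<close> by (auto simp: T_def)
  qed
  then have "polygon \<subseteq> (\<Union>(a, b)\<in>T. closed_segment a b)" unfolding polygon_def by blast
  moreover have "(\<Union>(a, b)\<in>T. closed_segment a b) \<subseteq> polygon" by (auto simp: T_def polygon_def)
  ultimately have "polygon = (\<Union>(a, b)\<in>T. closed_segment a b)" by blast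
  moreover have "finite T" "\<forall>(a, b)\<in>T. a \<noteq> b" using V_Suc_neq by (auto simp: T_def)
  ultimately show ?thesis unfolding finite_union_of_segments_def by blast
qed

lemma R_polygon: "R ` polygon = polygon"
proof -
  have R: "R (Zc + G y) = Zc + G (y + real l)" if "0 \<le> y" for y
    using G_add[OF that] by (simp add: R_def)
  have sub: "R ` polygon \<subseteq> polygon"
    unfolding polygon_eq_G_image using R by force
  then have "R (R (R (R z))) \<in> R ` polygon" if "z \<in> polygon" for z using that by blast
  then have "polygon \<subseteq> R ` polygon" by (simp add: subsetI)
  with sub show ?thesis by blast
qed

end

locale star_polygon_orbit = star_polygon +
  fixes f :: "complex \<Rightarrow> complex"
  assumes V_in_Sq: "V j \<in> Sq"
    and f_segment: "\<lbrakk>0 \<le> u; u \<le> 1\<rbrakk> \<Longrightarrow>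
      f ((1 - u) *\<^sub>R V j + u *\<^sub>R V (Suc j)) = (1 - u) *\<^sub>R V (Suc j) + u *\<^sub>R V (Suc (Suc j))"
begin

lemma f_G: "0 \<le> y \<Longrightarrow> f (Zc + G y) = Zc + G (y + 1)"
proof -
  assume "0 \<le> y"
  then obtain j where j: "real j \<le> y" "y < real (Suc j)" by (rule obtain_segment)
  have c: "Zc + ((1 - u) *\<^sub>R W i + u *\<^sub>R W k) = (1 - u) *\<^sub>R V i + u *\<^sub>R V k" for u i k
    by (simp add: W_def algebra_simps)
  have "Zc + G y = (1 - (y - real j)) *\<^sub>R V j + (y - real j) *\<^sub>R V (Suc j)"
    using G_segment[of j y] j c by simp
  moreover have "Zc + G (y + 1) = (1 - (y - real j)) *\<^sub>R V (Suc j) + (y - real j) *\<^sub>R V (Suc (Suc j))"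
    using G_segment[of "Suc j" "y + 1"] j c by simp
  ultimately show ?thesis using f_segment[of "y - real j" j] j by simp
qed

lemma f_curve: "f (curve (frac x)) = curve (frac (x + 1 / (4 * real l)))"
  using f_G[of "4 * real l * frac x"] curve_frac_add[of x] by (simp add: curve_def)

lemma invariant_polygon: "invariant_circle f polygon"
proof -
  have "polygon \<subseteq> Sq"
    unfolding polygon_def using closed_segment_subset[OF V_in_Sq V_in_Sq convex_Sq] by blast
  moreover have "f ` polygon \<subseteq> polygon"
    unfolding polygon_eq_G_image using f_G by force
  moreover have "polygon \<subseteq> f ` polygon"
  proof
    fix z assume "z \<in> polygon"
    then obtain y where y: "0 \<le> y" "z = Zc + G y" by (auto simp: polygon_eq_G_image)
    \<comment> \<open>Since \<open>y - 1\<close> may be negative, the preimage is taken one full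
      turn later.\<close>
    have "0 \<le> y + 4 * real l - 1" using y l_pos by simp
    from f_G[OF this] have "z = f (Zc + G (y + 4 * real l - 1))"
      using G_periodic[OF y(1)] y(2) by simp
    then show "z \<in> f ` polygon" using G_image_polygon[OF \<open>0 \<le> y + 4 * real l - 1\<close>] by blast
  qed
  moreover have "simple_closed_curve polygon"
    unfolding simple_closed_curve_def using simple_path_curve curve_closed path_image_curve by blast
  ultimately show ?thesis unfolding invariant_circle_def by blast
qed

text \<open>In the parameter of \<open>curve\<close> the map is translation by
  \<open>1 / (4 * l)\<close>, so the iterates of the lift are explicit.\<close>

lemma rotation_number_polygon: "has_rotation_number f polygon (1 / (4 * real l))"
proof -
  define c where "c = 1 / (4 * real l)"
  have c: "0 \<le> c" "c < 1" using l_pos by (auto simp: c_def divide_simps)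
  define h where "h = (\<lambda>x. x + c)"
  have "circle_lift f curve h"
    unfolding circle_lift_def h_def
    using f_curve by (auto simp: strict_mono_def c_def intro!: continuous_intros)
  moreover have "(\<lambda>n. (h ^^ n) x / real n) \<longlonglongrightarrow> c" for x
  proof -
    have "(h ^^ n) x = x + real n * c" for n
      by (induction n) (auto simp: h_def algebra_simps)
    then have "x / real n + c = (h ^^ n) x / real n" if "n > 0" for n
      using that by (simp add: field_simps)
    then have "\<forall>\<^sub>F n in sequentially. x / real n + c = (h ^^ n) x / real n"
      using eventually_gt_at_top[of 0] by (rule eventually_mono[rotated])
    moreover have "(\<lambda>n. x / real n + c) \<longlonglongrightarrow> 0 + c"
      by (intro tendsto_intros lim_const_over_n)
    ultimately show ?thesis using Lim_transform_eventually by fastforce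
  qed
  moreover have "c = frac c" using c by (simp add: frac_eq)
  ultimately show ?thesis
    unfolding has_rotation_number_def c_def[symmetric] using ccw_curve by blast
qed

lemma symmetric_polygon: "rotationally_symmetric f polygon"
proof -
  define c where "c = 1 / (4 * real l)"
  have c: "0 \<le> c" "c < 1" using l_pos by (auto simp: c_def divide_simps)
  have "f (curve x) = curve (frac (x + c))" if "x \<in> {0..<1}" for x
    using f_curve[of x] that by (simp add: c_def frac_eq)
  moreover have "frac (x + c) \<in> {0..<1}" for x by (simp add: frac_lt_1)
  ultimately have "preserves_cyclic_order_on polygon f"
    unfolding preserves_cyclic_order_on_def
    using simple_path_curve curve_closed path_image_curve cyclically_ordered_rotate[OF _ _ _ _ c]
    by (intro exI[of _ curve]) blast
  then show ?thesis
    unfolding rotationally_symmetric_def using center_inside R_polygon by blast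
qed

end

section \<open>The closing orbit\<close>

text \<open>If \<open>x\<close> solves \<open>x (n + 2) = (2 + d) * x (n + 1) - x n\<close> with
  both initial values 1, this is \<open>(x n - 1) / d\<close>, written as a polynomial in
  \<open>d\<close> so that it stays continuous at \<open>d = 0\<close>, the value at the angle pi/4.
  There it equals \<open>n * (n - 1) / 2\<close>.\<close>

fun growth :: "real \<Rightarrow> nat \<Rightarrow> real" where
  "growth d 0 = 0"
| "growth d (Suc 0) = 0"
| "growth d (Suc (Suc n)) = (2 + d) * growth d (Suc n) - growth d n + 1"

text \<open>By the recursion, successive increments differ by
  \<open>1 + d * growth d (Suc n)\<close>, which is at least 1.\<close>

lemma growth_increment:
  assumes "d \<ge> 0"
  shows "0 \<le> growth d n \<and> growth d n + real n \<le> growth d (Suc n)"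
proof (induction n)
  case (Suc n)
  then have "0 \<le> d * growth d (Suc n)" using assms by (intro mult_nonneg_nonneg) auto
  then show ?case using Suc by (auto simp: algebra_simps)
qed simp

lemma growth_lower_bound: "d \<ge> 0 \<Longrightarrow> real n - 1 \<le> growth d n"
proof (induction n)
  case (Suc n)
  then show ?case using growth_increment[of d n] by (cases n) auto
qed simp

lemma growth_mono: "d \<ge> 0 \<Longrightarrow> m \<le> n \<Longrightarrow> growth d m \<le> growth d n"
proof (rule lift_Suc_mono_le[of "growth d"])
  show "growth d n \<le> growth d (Suc n)" if "d \<ge> 0" for n
    using growth_increment[OF that, of n] by simp
qed

lemma convex_sequence_le_endpoints:
  fixes w :: "nat \<Rightarrow> real"
  assumes convex: "\<And>i. Suc i < n \<Longrightarrow> 2 * w (Suc i) \<le> w i + w (Suc (Suc i))"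
    and ends: "w 0 \<le> c" "w n \<le> c" and j: "j \<le> n"
  shows "w j \<le> c"
proof (cases "j = n")
  case False
  have inc: "w (Suc i) - w i \<le> w (Suc k) - w k" if "i \<le> k" "k < n" for i k
    using that by (induction rule: dec_induct) (use convex in force)+
  show ?thesis
  proof (cases "w j \<le> w (Suc j)")
    case True
    have "w j \<le> w k" if "j \<le> k" "k \<le> n" for k
      using that
    proof (induction rule: dec_induct)
      case (step k)
      then show ?case using inc[of j k] True by simp
    qed simp
    then show ?thesis using ends j by fastforce
  next
    case False
    have "w i \<le> w 0" if "i \<le> j" for i
      using that
    proof (induction i)
      case (Suc i)
      then show ?case using inc[of i j] False \<open>j \<noteq> n\<close> j by simp
    qed simp
    then show ?thesis using ends by fastforce
  qed
qed (use ends in simp)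

section \<open>The hyperbolic orbit in the corner\<close>

context pinwheel
begin

definition \<delta> :: real where "\<delta> = (1 - 2 * s)\<^sup>2 / (s - t)"

text \<open>\<open>X j\<close> is the first coordinate of the \<open>j\<close>-th image of \<open>P 4\<close> under the linear map \<open>MB\<close>,
  whose trace is \<open>2 + \<delta>\<close>.\<close>

definition X :: "nat \<Rightarrow> real" where "X j = t * (1 + \<delta> * growth \<delta> j)"

lemma \<delta>_pos: "\<delta> > 0"
  using t_less_s s_less by (simp add: \<delta>_def)

lemma X_0 [simp]: "X 0 = t" and X_1 [simp]: "X (Suc 0) = t"
  by (simp_all add: X_def)

lemma X_Suc_Suc: "X (Suc (Suc j)) = (2 + \<delta>) * X (Suc j) - X j"
  by (simp add: X_def algebra_simps)

lemma X_le_Suc: "X j \<le> X (Suc j)"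
  using growth_increment[of \<delta> j] \<delta>_pos t_pos by (simp add: X_def)

lemma X_mono: "i \<le> j \<Longrightarrow> X i \<le> X j"
  using X_le_Suc by (rule lift_Suc_mono_le)

lemma X_less: "1 \<le> i \<Longrightarrow> i < j \<Longrightarrow> X i < X j"
proof -
  assume "1 \<le> i" "i < j"
  have "growth \<delta> i < growth \<delta> (Suc i)"
    using growth_increment[of \<delta> i] \<delta>_pos \<open>1 \<le> i\<close> by simp
  then have "X i < X (Suc i)" using \<delta>_pos t_pos by (simp add: X_def)
  also have "\<dots> \<le> X j" using \<open>i < j\<close> by (intro X_mono) simp
  finally show ?thesis .
qed

lemma X_ge: "t \<le> X j"
  using X_mono[of 0 j] by simp

end

text \<open>The scalar closing equation. As \<open>(s - t) * \<delta> = (1 - 2 * s)^2\<close> and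
  \<open>(s - t)^2 = t * (1 - 2 * s)\<close>, it amounts to \<open>X K = s\<close>.\<close>

locale closing_pinwheel = pinwheel +
  fixes K :: nat
  assumes K_ge: "K \<ge> 2"
    and closing: "(1 - 2 * s) * growth \<delta> K = 1"
begin

lemma X_K: "X K = s"
proof -
  have "s - t > 0" "1 - 2 * s > 0" using t_less_s s_less by auto
  have "(s - t) * \<delta> = (1 - 2 * s) * (1 - 2 * s)"
    using \<open>s - t > 0\<close> by (simp add: \<delta>_def power2_eq_square)
  moreover have "(s - t) * (s - t) = t * (1 - 2 * s)" using s_square by algebra
  ultimately have "(s - t) * (X K - t) = (s - t) * (s - t)"
    using closing unfolding X_def by algebra
  then show ?thesis using \<open>s - t > 0\<close> by simp
qed

text \<open>A conserved quadratic form of the recursion: consecutive pairs stay on one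
  hyperbola.\<close>

lemma X_invariant: "(X j)\<^sup>2 + (X (Suc j))\<^sup>2 - (2 + \<delta>) * X j * X (Suc j) = - t\<^sup>2 * \<delta>"
proof (induction j)
  case 0
  show ?case by (simp add: algebra_simps power2_eq_square)
next
  case (Suc j)
  then show ?case unfolding X_Suc_Suc by algebra
qed

text \<open>With \<open>X K = s\<close> the conserved form is a quadratic equation for the next
  term. Its other root would make the term before \<open>X K\<close> equal to
  \<open>1 - s > s\<close>, against monotonicity.\<close>

lemma X_Suc_K: "X (Suc K) = 1 - s"
proof -
  have st0: "s - t > 0" using t_less_s by simp
  then have d: "(s - t) * \<delta> = (1 - 2 * s)\<^sup>2" by (simp add: \<delta>_def)
  have "(s - t) * (s\<^sup>2 + (1 - s)\<^sup>2 - (2 + \<delta>) * s * (1 - s)) = (s - t) * (- t\<^sup>2 * \<delta>)"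
    using d s_square by algebra
  then have "s\<^sup>2 + (1 - s)\<^sup>2 - (2 + \<delta>) * s * (1 - s) = - t\<^sup>2 * \<delta>"
    using st0 by (metis mult_left_cancel less_irrefl)
  with X_invariant[of K] have "(X (Suc K) - (1 - s)) * (X (Suc K) - ((2 + \<delta>) * s - (1 - s))) = 0"
    unfolding X_K by algebra
  moreover obtain k where k: "K = Suc k" using K_ge by (cases K) auto
  have "X k = (2 + \<delta>) * s - X (Suc K)" using X_Suc_Suc[of k] X_K k by simp
  moreover have "X k \<le> s" using X_mono[of k K] X_K k by simp
  ultimately show ?thesis using s_less by auto
qed

text \<open>The second coordinate runs through the same sequence backwards, because exchanging the
  coordinates conjugates \<open>MB\<close> to its inverse and swaps the ends
  \<open>P \<theta> 4\<close> and \<open>P' \<theta> 1\<close>.\<close>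

definition v :: "nat \<Rightarrow> complex" where "v j = Complex (X j) (X (Suc K - j))"

text \<open>Both coordinates of \<open>v\<close> obey the recursion with coefficient
  \<open>2 + \<delta>\<close>, which is unchanged by reversing the index. By linearity of
  \<open>MB\<close> the first two steps imply all others.\<close>

lemma MB_v: "j \<le> K \<Longrightarrow> MB (v j) = v (Suc j)"
proof (induction j rule: induct_nat_012)
  case 0
  have "MB (P \<theta> 4) = P' \<theta> 4"
    using piece_map0_verts[of "P \<theta> 4" 1] by (simp add: verts_def piece_map0_def)
  then show ?case using X_K X_Suc_K by (simp add: v_def P_simps P'_simps)
next
  case 1
  have st0: "s - t \<noteq> 0" using t_less_s by simp
  obtain k where k: "K = Suc k" using K_ge by (cases K) auto
  have r: "K - Suc 0 = k" by (simp add: k)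
  have "X k = (2 + \<delta>) * s - (1 - s)" using X_Suc_Suc[of k] X_K X_Suc_K k by simp
  then have v2: "v (Suc (Suc 0)) = Complex ((2 + \<delta>) * t - t) ((2 + \<delta>) * s - (1 - s))"
    and v1: "v (Suc 0) = Complex t s"
    using X_K r by (simp_all add: v_def X_Suc_Suc)
  have d: "(s - t) * \<delta> = (1 - 2 * s)\<^sup>2" using st0 by (simp add: \<delta>_def)
  have "(1 - s - t) * (1 - s + t) * t - t * (1 - 2 * s) * s = ((2 + \<delta>) * t - t) * (s - t)"
    using d s_square by algebra
  moreover have "t * (1 - 2 * s) * t + (s + t) * s * (s - t) = ((2 + \<delta>) * s - (1 - s)) * (s - t)"
    using d s_square by algebra
  ultimately show ?case
    unfolding v1 v2 MB_def complex_eq_iff using st0 by (simp add: divide_simps)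
next
  case (ge2 j)
  have MB_lin: "MB (Complex (a * x - x') (a * y - y'))
      = Complex (a * Re (MB (Complex x y)) - Re (MB (Complex x' y'))) (a * Im (MB (Complex x y)) - Im (MB (Complex x' y')))"
    for a x y x' y'
  proof -
    have "Complex (a * x - x') (a * y - y') = a *\<^sub>R Complex x y - Complex x' y'" by (simp add: complex_eq_iff)
    then show ?thesis
      by (simp only: linear_diff[OF linear_MB] linear_scale[OF linear_MB]) (simp add: complex_eq_iff)
  qed
  obtain i where i: "K = j + 2 + i" using ge2.prems le_Suc_ex by force
  have r1: "Suc K - j = Suc (Suc (Suc i))" "Suc K - Suc j = Suc (Suc i)" "Suc K - Suc (Suc j) = Suc i"
    "Suc K - Suc (Suc (Suc j)) = i" by (simp_all add: i)
  have y: "X i = (2 + \<delta>) * X (Suc i) - X (Suc (Suc i))" "X (Suc i) = (2 + \<delta>) * X (Suc (Suc i)) - X (Suc (Suc (Suc i)))"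
    by (simp_all add: X_Suc_Suc)
  have "v (Suc (Suc j)) = Complex ((2 + \<delta>) * X (Suc j) - X j) ((2 + \<delta>) * X (Suc (Suc i)) - X (Suc (Suc (Suc i))))"
    unfolding v_def r1 X_Suc_Suc[of j] y(2)[symmetric] ..
  moreover have "MB (Complex (X j) (X (Suc (Suc (Suc i))))) = v (Suc j)"
    "MB (Complex (X (Suc j)) (X (Suc (Suc i)))) = v (Suc (Suc j))"
    using ge2.IH ge2.prems unfolding v_def[of j] v_def[of "Suc j"] r1 by simp_all
  ultimately have "MB (v (Suc (Suc j))) = Complex ((2 + \<delta>) * Re (v (Suc (Suc j))) - Re (v (Suc j)))
      ((2 + \<delta>) * Im (v (Suc (Suc j))) - Im (v (Suc j)))"
    by (simp only: MB_lin)
  also have "\<dots> = v (Suc (Suc (Suc j)))"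
    unfolding v_def r1 complex.sel X_Suc_Suc[of "Suc j"] y(1) ..
  finally show ?case .
qed

lemma v_endpoints: "v 0 = Complex t (1 - s)" "v K = Complex s t" "v (Suc K) = Complex (1 - s) t" "v 1 = Complex t s"
  using X_K X_Suc_K by (simp_all add: v_def)

text \<open>The functional equals \<open>t\<close> at both ends \<open>P \<theta> 4\<close> and
  \<open>P \<theta> 1\<close>, and its second differences along the orbit are \<delta> times
  positive values. A convex sequence stays below its end values: the hyperbola bends towards the
  corner.\<close>

lemma v_below_chord: "j \<le> K \<Longrightarrow> s * Re (v j) + t * Im (v j) \<le> t"
proof (rule convex_sequence_le_endpoints[where w = "\<lambda>j. s * Re (v j) + t * Im (v j)" and n = K])
  fix i assume "Suc i < K"
  then have k: "K = Suc i + Suc (K - Suc (Suc i))" by simp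
  define k where "k = K - Suc (Suc i)"
  have r: "K - i = Suc (Suc k)" "Suc K - i = Suc (Suc (Suc k))" "K - Suc i = Suc k"
    using k unfolding k_def by simp_all
  have "0 \<le> \<delta> * (s * X (Suc i) + t * X (Suc (Suc k)))"
    using \<delta>_pos t_pos t_less_s X_ge[of "Suc i"] X_ge[of "Suc (Suc k)"] by (intro mult_nonneg_nonneg add_nonneg_nonneg) auto
  then show "2 * (s * Re (v (Suc i)) + t * Im (v (Suc i)))
      \<le> s * Re (v i) + t * Im (v i) + (s * Re (v (Suc (Suc i))) + t * Im (v (Suc (Suc i))))"
    by (simp add: v_def r X_Suc_Suc[of i] X_Suc_Suc[of "Suc k"] algebra_simps)
qed (use s_square in \<open>simp_all add: v_endpoints algebra_simps\<close>)

lemma scaled_v_in_B: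
  assumes "j \<le> K" "0 \<le> r" "r \<le> 1"
  shows "r *\<^sub>R v j \<in> convex hull verts 1 1"
proof -
  define x y where "x = Re (v j)" and "y = Im (v j)"
  have st0: "s - t > 0" "0 < 1 - s" "s > 0" using t_less_s s_less t_pos by auto
  have x: "t \<le> x" "x \<le> s" using X_ge[of j] X_mono[OF assms(1)] X_K by (auto simp: x_def v_def)
  have y: "t \<le> y" "y \<le> 1 - s"
    using X_ge[of "Suc K - j"] X_mono[of "Suc K - j" "Suc K"] X_Suc_K by (auto simp: y_def v_def)
  \<comment> \<open>Cramer's rule for the coefficients of \<open>P \<theta> 1\<close> and
    \<open>P \<theta> 4\<close>. The ranges of \<open>x\<close> and \<open>y\<close> make them
    nonnegative, and the chord bounds their sum by 1.\<close>
  define \<alpha> \<beta> where "\<alpha> = ((1 - s) * x - t * y) / (s - t)" and "\<beta> = (s * y - t * x) / (s - t)"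
  have ab: "(s - t) * \<alpha> = (1 - s) * x - t * y" "(s - t) * \<beta> = s * y - t * x"
    using st0 by (simp_all add: \<alpha>_def \<beta>_def)
  have "t * y \<le> t * (1 - s)" "(1 - s) * t \<le> (1 - s) * x" "t * x \<le> t * s" "s * t \<le> s * y"
    using x y t_pos st0 by (simp_all add: mult_left_mono)
  then have "0 \<le> (s - t) * \<alpha>" "0 \<le> (s - t) * \<beta>" unfolding ab by (simp_all add: mult.commute)
  then have nn: "0 \<le> \<alpha>" "0 \<le> \<beta>" using st0 by (simp_all add: zero_le_mult_iff)
  have "\<alpha> + \<beta> \<le> 1"
  proof -
    have "s * ((s - t) * (1 - \<alpha> - \<beta>)) = (1 - s - t) * (t - s * x - t * y)"
      using ab s_square by algebra
    also have "\<dots> \<ge> 0" using v_below_chord[OF assms(1)] t_less_s s_less by (simp add: x_def y_def)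
    finally have "0 \<le> (s * (s - t)) * (1 - \<alpha> - \<beta>)" by (simp add: mult.assoc)
    then have "0 \<le> 1 - \<alpha> - \<beta>" using mult_pos_pos[OF st0(3,1)] by (simp only: zero_le_mult_iff) auto
    then show ?thesis by simp
  qed
  then have "0 \<le> 1 - r * \<alpha> - r * \<beta>"
    using mult_mono[of r 1 "\<alpha> + \<beta>" 1] assms nn by (simp add: distrib_left)
  moreover have "r *\<^sub>R v j = (1 - r * \<alpha> - r * \<beta>) *\<^sub>R Complex 0 0 + (r * \<alpha>) *\<^sub>R Complex s t + (r * \<beta>) *\<^sub>R Complex t (1 - s)"
  proof -
    have "(s - t) * x = (s - t) * (\<alpha> * s + \<beta> * t)" "(s - t) * y = (s - t) * (\<alpha> * t + \<beta> * (1 - s))"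
      using ab s_square by algebra+
    then have "x = \<alpha> * s + \<beta> * t" "y = \<alpha> * t + \<beta> * (1 - s)" using st0 by auto
    moreover have "r *\<^sub>R v j = Complex (r * x) (r * y)" by (simp add: complex_eq_iff x_def y_def)
    ultimately show ?thesis by (simp only:) (simp add: complex_eq_iff algebra_simps)
  qed
  moreover have "0 \<le> r * \<alpha>" "0 \<le> r * \<beta>" using assms nn by auto
  moreover have "(1 - r * \<alpha> - r * \<beta>) + r * \<alpha> + r * \<beta> = 1" by simp
  ultimately show ?thesis
    unfolding verts_simps convex_hull_3 by blast
qed

end

section \<open>The periodic orbit for fixed N\<close>

locale closing_orbit = closing_pinwheel +
  fixes N :: nat
begin

definition l :: nat where "l = K + N"

definition scale :: real where "scale = 1 / (real N * (1 - 2 * s) + 1)"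

text \<open>The orbit of \<open>scale *\<^sub>R P 4\<close> up to the next corner: it first follows the hyperbola of
  \<open>MB\<close> in \<open>\<B>\<^sub>1\<close>, reaches \<open>scale *\<^sub>R P 1\<close> at time \<open>K\<close>, and is then sheared along a horizontal
  line in \<open>\<A>\<^sub>1\<close>.\<close>

definition base :: "nat \<Rightarrow> complex" where
  "base j = (if j \<le> K then scale *\<^sub>R v j
     else Complex (scale * (s + (real j - real K) * (1 - 2 * s))) (scale * t))"

definition Z :: "nat \<Rightarrow> complex" where "Z j = (R ^^ (j div l)) (base (j mod l))"

lemma scale_denom: "0 < real N * (1 - 2 * s) + 1" "1 \<le> real N * (1 - 2 * s) + 1"
proof -
  have "0 \<le> real N * (1 - 2 * s)" using s_less by simp
  then show "0 < real N * (1 - 2 * s) + 1" "1 \<le> real N * (1 - 2 * s) + 1" by simp_all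
qed

lemma scale_eq: "scale * (real N * (1 - 2 * s)) = 1 - scale"
proof -
  have "scale * (real N * (1 - 2 * s) + 1) = 1" using scale_denom by (simp add: scale_def)
  then show ?thesis by (simp add: algebra_simps)
qed

lemma scale_bounds: "0 < scale" "scale \<le> 1"
  using scale_denom by (simp_all add: scale_def)

lemma base_ge_K: "K \<le> j \<Longrightarrow> base j = Complex (scale * (s + (real j - real K) * (1 - 2 * s))) (scale * t)"
  by (cases "j = K") (simp_all add: base_def v_endpoints complex_eq_iff)

lemma base_l: "base l = R (base 0)"
  using scale_eq
  by (simp add: base_ge_K l_def base_def[of 0] v_endpoints complex_eq_iff algebra_simps)

text \<open>The image of the last side before the next corner is the rotated first side, so both of
  its endpoints have to match, not only the rotated starting point.\<close>

lemma base_Suc_l: "base (Suc l) = R (base 1)"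
  using scale_eq K_ge
  by (simp add: base_ge_K l_def base_def[of 1] base_def[of "Suc 0"] v_endpoints[simplified] complex_eq_iff algebra_simps)

lemma base_in_B: "j \<le> K \<Longrightarrow> base j \<in> convex hull verts 1 1"
  using scaled_v_in_B scale_bounds by (simp add: base_def)

lemma base_in_A:
  assumes "K \<le> j" "j \<le> l"
  shows "base j \<in> convex hull verts 0 1"
proof -
  obtain i where i: "j = K + i" "i \<le> N" using assms le_Suc_ex by (auto simp: l_def)
  define a where "a = scale * (real i * (1 - 2 * s))"
  have "0 \<le> scale * (real (N - i) * (1 - 2 * s))" using scale_bounds s_less by simp
  also have "\<dots> = 1 - scale - a" using scale_eq i(2) by (simp add: a_def of_nat_diff algebra_simps)
  finally have "0 \<le> 1 - scale - a" .
  moreover have "0 \<le> a" using scale_bounds s_less by (simp add: a_def)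
  moreover have "0 \<le> scale" using scale_bounds by simp
  moreover have "base j = (1 - scale - a) *\<^sub>R Complex 0 0 + a *\<^sub>R Complex 1 0 + scale *\<^sub>R Complex s t"
    using assms by (simp add: base_ge_K i a_def complex_eq_iff algebra_simps)
  moreover have "(1 - scale - a) + a + scale = 1" by simp
  ultimately show ?thesis unfolding verts_simps convex_hull_3 by blast
qed

text \<open>\<open>base K\<close> is a multiple of \<open>P \<theta> 1\<close>, hence lies on the
  edge common to \<B>_1 and \<A>_1. No side crosses a break line, and each can be handled by a
  single affine formula.\<close>

lemma base_segment_image:
  assumes "j < l" "0 \<le> u" "u \<le> 1"
  shows "F \<theta> ((1 - u) *\<^sub>R base j + u *\<^sub>R base (Suc j)) = (1 - u) *\<^sub>R base (Suc j) + u *\<^sub>R base (Suc (Suc j))"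
proof -
  have *: "F \<theta> ((1 - u) *\<^sub>R base j + u *\<^sub>R base (Suc j)) = (1 - u) *\<^sub>R base (Suc j) + u *\<^sub>R base (Suc (Suc j))"
    if k: "k \<le> 2" "base j \<in> convex hull verts k 1" "base (Suc j) \<in> convex hull verts k 1"
      and im: "piece_map0 k (base j) = base (Suc j)" "piece_map0 k (base (Suc j)) = base (Suc (Suc j))" for k
  proof -
    have "(1 - u) *\<^sub>R base j + u *\<^sub>R base (Suc j) \<in> convex hull verts k 1"
      using k assms by (intro convexD_alt convex_convex_hull)
    then have "F \<theta> ((1 - u) *\<^sub>R base j + u *\<^sub>R base (Suc j)) = piece_map k 1 ((1 - u) *\<^sub>R base j + u *\<^sub>R base (Suc j))"
      using F_eq_piece_map k by blast
    also have "\<dots> = (1 - u) *\<^sub>R base (Suc j) + u *\<^sub>R base (Suc (Suc j))"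
      using real_affine_segment[OF real_affine_piece_map[of k 1], of u "base j" "base (Suc j)"]
      unfolding piece_map_1 im .
    finally show ?thesis .
  qed
  show ?thesis
  proof (cases "j < K")
    case True
    have MB: "MB (base i) = base (Suc i)" if "i \<le> K" for i
    proof -
      have "MB (base i) = scale *\<^sub>R v (Suc i)"
        using MB_v[OF that] that by (simp add: base_def linear_scale[OF linear_MB])
      also have "\<dots> = base (Suc i)"
      \<comment> \<open>At the junction the two branches of \<open>base\<close> meet: the image of
        \<open>P \<theta> 1\<close> under \<open>MB\<close> is also its image under the
        shear.\<close>
      proof (cases "i = K")
        case True
        then show ?thesis by (simp add: base_def v_endpoints complex_eq_iff algebra_simps)
      qed (use that in \<open>simp add: base_def\<close>)
      finally show ?thesis .
    qed
    show ?thesis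
      by (rule *[of 1]) (use True MB[of j] MB[of "Suc j"] base_in_B in \<open>auto simp: piece_map0_def\<close>)
  next
    case False
    have MA: "MA (base i) = base (Suc i)" if "K \<le> i" for i
    proof -
      have "(1 - 2 * s) / t * (scale * t) = scale * (1 - 2 * s)" using t_pos by simp
      then show ?thesis
        using that unfolding MA_def by (simp only: base_ge_K le_SucI complex.sel) (simp add: algebra_simps)
    qed
    show ?thesis
      by (rule *[of 0]) (use False assms(1) MA[of j] MA[of "Suc j"] base_in_A in \<open>auto simp: piece_map0_def\<close>)
  qed
qed

lemma base_in_Sq: "j \<le> l \<Longrightarrow> base j \<in> Sq"
  using base_in_B[of j] base_in_A[of j] hull_verts_subset_Sq by (cases "j \<le> K") auto

lemma l_ge: "l \<ge> 2"
  using K_ge by (simp add: l_def)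

lemma Z_add: "Z (j + l) = R (Z j)"
  using l_ge by (simp add: Z_def)

lemma Z_eq_base: "j < l \<Longrightarrow> i \<le> 2 \<Longrightarrow> j + i \<le> Suc l \<Longrightarrow> Z (a * l + j + i) = (R ^^ a) (base (j + i))"
proof -
  assume "j < l" "i \<le> 2" "j + i \<le> Suc l"
  then consider "j + i < l" | "j + i = l" | "j + i = Suc l" by linarith
  then show ?thesis
  proof cases
    case 1
    then show ?thesis by (simp add: Z_def add.assoc)
  next
    case 2
    then have "a * l + j + i = l * Suc a" by simp
    then show ?thesis using l_ge 2 base_l by (simp only: Z_def) (simp add: funpow_swap1)
  next
    case 3
    then have "a * l + j + i = 1 + l * Suc a" by simp
    then show ?thesis using l_ge 3 base_Suc_l
      by (simp only: Z_def mod_mult_self2 div_mult_self2) (simp add: funpow_swap1)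
  qed
qed

lemma F_funpow_R: "z \<in> Sq \<Longrightarrow> F \<theta> ((R ^^ n) z) = (R ^^ n) (F \<theta> z)"
proof (induction n)
  case (Suc n)
  have "(R ^^ n) z \<in> Sq" using Suc.prems by (induction n) auto
  then show ?case using Suc F_R by simp
qed simp

lemma obtain_Z:
  obtains a r where "r < l" "Z j = (R ^^ a) (base r)" "Z (Suc j) = (R ^^ a) (base (Suc r))"
    "Z (Suc (Suc j)) = (R ^^ a) (base (Suc (Suc r)))"
proof
  show r: "j mod l < l" using l_ge by simp
  have j: "j = j div l * l + j mod l" by (rule div_mult_mod_eq[symmetric])
  show "Z j = (R ^^ (j div l)) (base (j mod l))" by (simp add: Z_def)
  show "Z (Suc j) = (R ^^ (j div l)) (base (Suc (j mod l)))"
    using Z_eq_base[of "j mod l" 1 "j div l"] r j[symmetric] by simp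
  show "Z (Suc (Suc j)) = (R ^^ (j div l)) (base (Suc (Suc (j mod l))))"
    using Z_eq_base[of "j mod l" 2 "j div l"] r j[symmetric] by simp
qed

lemma Z_in_Sq: "Z j \<in> Sq"
proof -
  obtain a r where "r < l" "Z j = (R ^^ a) (base r)" by (rule obtain_Z)
  moreover have "(R ^^ a) z \<in> Sq" if "z \<in> Sq" for z using that by (induction a) auto
  ultimately show ?thesis using base_in_Sq[of r] by simp
qed

lemma Z_segment_image:
  assumes "0 \<le> u" "u \<le> 1"
  shows "F \<theta> ((1 - u) *\<^sub>R Z j + u *\<^sub>R Z (Suc j)) = (1 - u) *\<^sub>R Z (Suc j) + u *\<^sub>R Z (Suc (Suc j))"
proof -
  obtain a r where r: "r < l" "Z j = (R ^^ a) (base r)" "Z (Suc j) = (R ^^ a) (base (Suc r))"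
    "Z (Suc (Suc j)) = (R ^^ a) (base (Suc (Suc r)))" by (rule obtain_Z)
  have "(1 - u) *\<^sub>R base r + u *\<^sub>R base (Suc r) \<in> Sq"
    using base_in_Sq[of r] base_in_Sq[of "Suc r"] r(1) assms convex_Sq by (intro convexD_alt) auto
  from F_funpow_R[OF this, of a] show ?thesis
    unfolding r(2-4) base_segment_image[OF r(1) assms]
      real_affine_segment[OF real_affine_funpow[OF real_affine_R]] .
qed

text \<open>Seen from the centre, the points with index 1 to \<open>K\<close> are in the open lower
  left quadrant and move right and down; afterwards they move right at constant height below the
  centre. Both motions increase the angle. Index 0 is left out because \<open>base 0\<close> may be
  above the centre.\<close>

lemma cross_base_pos:
  assumes "1 \<le> j" "j < k" "k \<le> Suc l"
  shows "cross (base j - Zc) (base k - Zc) > 0"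
proof -
  define xc yc where "xc j = Re (base j - Zc)" and "yc j = Im (base j - Zc)" for j
  have crossc: "cross (base j - Zc) (base k - Zc) = xc j * yc k - yc j * xc k"
    by (simp add: xc_def yc_def)
  have corner: "xc i = scale * X i - 1/2" "yc i = scale * X (Suc K - i) - 1/2" if "i \<le> K" for i
    using that by (simp_all add: xc_def yc_def base_def v_def Zc_def)
  have bottom: "xc i = scale * (s + (real i - real K) * (1 - 2 * s)) - 1/2" "yc i = scale * t - 1/2" if "K \<le> i" for i
    using that by (simp_all add: xc_def yc_def base_ge_K Zc_def)
  have scale_less: "scale * x < 1/2" if "x < 1/2" "0 \<le> x" for x
    using mult_left_le_one_le[of x scale] scale_bounds that by linarith
  have neg: "xc i < 0" "yc i < 0" if "1 \<le> i" "i \<le> K" for i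
  proof -
    have "X i \<le> s" "X (Suc K - i) \<le> s" using X_mono[of _ K] X_K that by (metis, metis Suc_diff_le diff_Suc_Suc diff_le_self One_nat_def Suc_le_D)
    then show "xc i < 0" "yc i < 0"
      using corner[OF that(2)] scale_less[of "X i"] scale_less[of "X (Suc K - i)"] X_ge[of i] X_ge[of "Suc K - i"] s_less t_pos
      by auto
  qed
  have xinc: "xc i < xc i'" if "1 \<le> i" "i < i'" "i' \<le> K" for i i'
    using X_less[OF that(1,2)] corner that scale_bounds by simp
  have ydec: "yc i > yc i'" if "1 \<le> i" "i < i'" "i' \<le> K" for i i'
    using X_less[of "Suc K - i'" "Suc K - i"] corner that scale_bounds by simp
  have xinc': "xc i < xc i'" if "K \<le> i" "i < i'" for i i'
    using bottom that scale_bounds s_less by simp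
  consider "k \<le> K" | "K \<le> j" | "j < K" "K < k" by linarith
  then show ?thesis
  proof cases
    case 1
    have "(- xc k) * (- yc j) < (- xc j) * (- yc k)"
      using xinc[of j k] ydec[of j k] neg[of k] neg[of j] assms 1 by (intro mult_strict_mono) auto
    then show ?thesis unfolding crossc by (simp add: mult.commute)
  next
    case 2
    have "yc K < 0" using neg[of K] K_ge by simp
    then have "(xc k - xc j) * (- yc K) > 0" using xinc'[of j k] assms 2 by (intro mult_pos_pos) auto
    moreover have "yc j = yc K" "yc k = yc K" using bottom 2 assms by auto
    ultimately show ?thesis unfolding crossc by (simp add: algebra_simps)
  next
    case 3
    \<comment> \<open>The turning point \<open>base K\<close> serves as intermediate point between
      the two phases.\<close>
    have n: "xc j < 0" "yc j < 0" "xc K < 0" "xc j < xc K" "xc K < xc k" "yc K < yc j" "yc k = yc K"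
      using neg[of j] neg[of K] xinc[of j K] xinc'[of K k] ydec[of j K] bottom[of k] bottom[of K] assms 3 K_ge by auto
    have "(- xc K) * (- yc j) < (- xc j) * (- yc k)" using n by (intro mult_strict_mono) auto
    moreover have "(- yc j) * xc K < (- yc j) * xc k" using n by (intro mult_strict_left_mono) auto
    ultimately show ?thesis unfolding crossc by (simp add: algebra_simps)
  qed
qed

text \<open>The shift by one matches the index range of \<open>cross_base_pos\<close>.\<close>

sublocale star_polygon_orbit "\<lambda>j. Z (Suc j)" l "F \<theta>"
proof
  have Zb: "Z i = base i" if "1 \<le> i" "i \<le> Suc l" for i
  proof (cases "i = Suc l")
    case True
    then show ?thesis using Z_eq_base[of "l - 1" 2 0] l_ge by simp
  next
    case False
    then show ?thesis using Z_eq_base[of "i - 1" 1 0] that by simp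
  qed
  show "cross (Z (Suc j) - Zc) (Z (Suc k) - Zc) > 0" if "j < k" "k \<le> l" for j k
    using cross_base_pos[of "Suc j" "Suc k"] Zb[of "Suc j"] Zb[of "Suc k"] that by simp
  show "Z (Suc (j + l)) = R (Z (Suc j))" for j using Z_add[of "Suc j"] by simp
qed (use l_ge Z_in_Sq Z_segment_image in auto)

end

section \<open>Convergence to the boundary and choice of the angles\<close>

lemma infdist_le_if_near:
  assumes "\<exists>b\<in>B. dist a b \<le> d"
  shows "infdist a B \<le> d"
  using assms by (meson infdist_le2)

lemma hausdorff_dist_bounds:
  assumes "A \<noteq> {}" "B \<noteq> {}"
    and A: "\<And>a. a \<in> A \<Longrightarrow> \<exists>b\<in>B. dist a b \<le> d"
    and B: "\<And>b. b \<in> B \<Longrightarrow> \<exists>a\<in>A. dist b a \<le> d"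
  shows "0 \<le> hausdorff_dist A B" "hausdorff_dist A B \<le> d"
proof -
  have a: "infdist a B \<le> d" if "a \<in> A" for a using A[OF that] by (rule infdist_le_if_near)
  have b: "infdist b A \<le> d" if "b \<in> B" for b using B[OF that] by (rule infdist_le_if_near)
  show "hausdorff_dist A B \<le> d"
    unfolding hausdorff_dist_def using assms(1,2) a b by (intro max.boundedI cSUP_least)
  obtain a0 where a0: "a0 \<in> A" using assms(1) by blast
  \<comment> \<open>A real supremum is informative only for bounded sets, so boundedness precedes
    the comparison with one element.\<close>
  have "bdd_above ((\<lambda>a. infdist a B) ` A)" using a by (intro bdd_aboveI2)
  then have "infdist a0 B \<le> (SUP a\<in>A. infdist a B)" using a0 by (intro cSUP_upper)
  then have "0 \<le> (SUP a\<in>A. infdist a B)" using infdist_nonneg order_trans by blast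
  then show "0 \<le> hausdorff_dist A B" by (simp add: hausdorff_dist_def)
qed

lemma frontier_Sq: "frontier Sq = {z \<in> Sq. Re z = 0 \<or> Re z = 1 \<or> Im z = 0 \<or> Im z = 1}"
proof -
  have Sq: "Sq = cbox 0 (Complex 1 1)" by (auto simp: Sq_def in_cbox_complex_iff)
  show ?thesis unfolding Sq frontier_cbox
    by (rule set_eqI) (simp add: in_cbox_complex_iff in_box_complex_iff, linarith)
qed

lemma zero_in_frontier_Sq: "0 \<in> frontier Sq"
  unfolding frontier_Sq by (simp add: Sq_def)

lemma frontier_Sq_R: "R z \<in> frontier Sq \<longleftrightarrow> z \<in> frontier Sq"
  by (auto simp: frontier_Sq)

lemma dist_R: "dist (R z) (R w) = dist z w"
proof -
  have "R z - R w = \<i> * (z - w)" by (simp add: R_def algebra_simps)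
  then show ?thesis by (simp add: dist_norm norm_mult)
qed

lemma dist_funpow_R: "dist ((R ^^ n) z) ((R ^^ n) w) = dist z w"
  by (induction n) (simp_all add: dist_R)

lemma dist_le_abs: "dist z w \<le> \<bar>Re z - Re w\<bar> + \<bar>Im z - Im w\<bar>"
  using cmod_le[of "z - w"] by (simp add: dist_norm)

section \<open>Distance between the polygon and the boundary\<close>

context closing_orbit
begin

lemma polygon_eq_Z: "z \<in> polygon \<longleftrightarrow> (\<exists>j. z \<in> closed_segment (Z (Suc j)) (Z (Suc (Suc j))))"
  by (simp add: polygon_def)

text \<open>Sides in the corner lie in a ball of radius \<open>2 * scale\<close> around the corner,
  since the unscaled points have norm at most 2; the remaining sides have height
  \<open>scale * t\<close> above the bottom edge.\<close>

lemma polygon_near_frontier: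
  assumes "z \<in> polygon"
  shows "\<exists>b\<in>frontier Sq. dist z b \<le> 2 * scale"
proof -
  obtain j where "z \<in> closed_segment (Z (Suc j)) (Z (Suc (Suc j)))"
    using assms by (auto simp: polygon_eq_Z)
  then obtain u where u: "0 \<le> u" "u \<le> 1" "z = (1 - u) *\<^sub>R Z (Suc j) + u *\<^sub>R Z (Suc (Suc j))"
    by (auto simp: closed_segment_def)
  obtain a r where r: "r < l" "Z (Suc j) = (R ^^ a) (base r)" "Z (Suc (Suc j)) = (R ^^ a) (base (Suc r))"
    by (rule obtain_Z)
  define w where "w = (1 - u) *\<^sub>R base r + u *\<^sub>R base (Suc r)"
  have z: "z = (R ^^ a) w"
    unfolding u(3) r(2,3) w_def real_affine_segment[OF real_affine_funpow[OF real_affine_R]] ..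
  have "\<exists>b\<in>frontier Sq. dist w b \<le> 2 * scale"
  proof (cases "r < K")
    case True
    have "base i \<in> cball 0 (2 * scale)" if "i \<le> K" for i
    proof -
      have "0 \<le> X i" "X i \<le> 1" "0 \<le> X (Suc K - i)" "X (Suc K - i) \<le> 1"
        using X_ge[of i] X_ge[of "Suc K - i"] t_pos t_less_s X_mono[of i "Suc K"] X_mono[of "Suc K - i" "Suc K"] X_Suc_K that by auto
      then have "cmod (v i) \<le> 2" using cmod_le[of "v i"] by (simp add: v_def)
      then have "scale * cmod (v i) \<le> scale * 2" using scale_bounds by (intro mult_left_mono) auto
      then show ?thesis using that scale_bounds by (simp add: base_def mult.commute)
    qed
    then have "w \<in> cball 0 (2 * scale)"
      unfolding w_def using True u by (intro convexD_alt convex_cball) auto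
    then have "dist w 0 \<le> 2 * scale" by (simp add: dist_commute)
    then show ?thesis using zero_in_frontier_Sq by blast
  next
    case False
    have "Im w = scale * t" using False by (simp add: w_def base_ge_K algebra_simps)
    moreover have "w \<in> Sq" using False u r(1) base_in_Sq[of r] base_in_Sq[of "Suc r"]
      unfolding w_def by (intro convexD_alt convex_Sq) auto
    ultimately have "dist w (Complex (Re w) 0) \<le> scale * t" "0 \<le> Re w" "Re w \<le> 1"
      using dist_le_abs[of w "Complex (Re w) 0"] scale_bounds t_pos by (auto simp: Sq_def)
    moreover from this have "Complex (Re w) 0 \<in> frontier Sq" unfolding frontier_Sq by (simp add: Sq_def)
    moreover have "scale * t \<le> scale * 2" using scale_bounds t_less_s s_less by (intro mult_left_mono) auto
    ultimately show ?thesis by (intro bexI[of _ "Complex (Re w) 0"]) auto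
  qed
  then obtain b where "b \<in> frontier Sq" "dist w b \<le> 2 * scale" by blast
  moreover have "(R ^^ a) b \<in> frontier Sq" using \<open>b \<in> frontier Sq\<close> by (induction a) (auto simp: frontier_Sq_R)
  ultimately show ?thesis using dist_funpow_R z by metis
qed

lemma R_in_polygon: "z \<in> polygon \<Longrightarrow> (R ^^ n) z \<in> polygon"
  using R_polygon by (induction n) auto

text \<open>The sides of \<open>polygon\<close> are indexed from \<open>Z 1\<close>, so the side
  from \<open>base 0\<close> is found one quarter later and rotated back by
  \<open>R ^^ 3\<close>.\<close>

lemma base_segment_in_polygon:
  assumes "j < l" "0 \<le> u" "u \<le> 1"
  shows "(1 - u) *\<^sub>R base j + u *\<^sub>R base (Suc j) \<in> polygon"
proof -
  have "Z (1 * l + j + 0) = R (base j)" "Z (1 * l + j + 1) = R (base (Suc j))"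
    using Z_eq_base[of j 0 1] Z_eq_base[of j 1 1] assms by simp_all
  moreover obtain i where "1 * l + j = Suc i" using l_ge by (cases "1 * l + j") auto
  ultimately have "R ((1 - u) *\<^sub>R base j + u *\<^sub>R base (Suc j)) = (1 - u) *\<^sub>R Z (Suc i) + u *\<^sub>R Z (Suc (Suc i))"
    by (simp add: real_affine_segment[OF real_affine_R])
  also have "\<dots> \<in> polygon"
    unfolding polygon_eq_Z closed_segment_def using assms by (intro exI[of _ i]) auto
  finally have "(R ^^ 3) (R ((1 - u) *\<^sub>R base j + u *\<^sub>R base (Suc j))) \<in> polygon" by (rule R_in_polygon)
  then show ?thesis by (simp add: numeral_3_eq_3)
qed

lemma bottom_in_polygon:
  assumes "scale * s \<le> x" "x \<le> 1 - scale * (1 - s)"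
  shows "Complex x (scale * t) \<in> polygon"
proof -
  define c where "c = scale * (1 - 2 * s)"
  have c: "c > 0" using scale_bounds s_less by (simp add: c_def)
  have "1 - scale * (1 - s) = scale * s + real N * c" using scale_eq by (simp add: c_def algebra_simps)
  then have y: "0 \<le> (x - scale * s) / c" "(x - scale * s) / c \<le> real N" using assms c by (simp_all add: field_simps)
  \<comment> \<open>The ceiling minus one keeps \<open>i < N\<close> at the right end. For
    \<open>N = 0\<close> the horizontal range shrinks to the point \<open>base K\<close>, which is
    the end of the last corner side.\<close>
  define i where "i = nat (\<lceil>(x - scale * s) / c\<rceil> - 1)"
  show ?thesis
  proof (cases "N = 0")
    case True
    then have "x = scale * s" using y c assms by (simp add: field_simps)
    moreover have "base K = Complex (scale * s) (scale * t)" by (simp add: base_ge_K)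
    moreover have "K - 1 < l" using K_ge by (simp add: l_def)
    ultimately show ?thesis
      using base_segment_in_polygon[of "K - 1" 1] K_ge by simp
  next
    case False
    have i: "real i \<le> (x - scale * s) / c" "(x - scale * s) / c \<le> real i + 1" "i < N"
      unfolding i_def using y False by linarith+
    define u where "u = (x - scale * s) / c - real i"
    have "x = scale * s + (real i + u) * c" using c by (simp add: u_def)
    then have "Complex x (scale * t) = (1 - u) *\<^sub>R base (K + i) + u *\<^sub>R base (Suc (K + i))"
      by (simp add: base_ge_K complex_eq_iff c_def algebra_simps)
    then show ?thesis
      using base_segment_in_polygon[of "K + i" u] i by (simp add: l_def u_def)
  qed
qed

lemma frontier_near_polygon:
  assumes "b \<in> frontier Sq"
  shows "\<exists>z\<in>polygon. dist b z \<le> 2 * scale"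
proof -
  have bottom: "\<exists>z\<in>polygon. dist b z \<le> 2 * scale" if b: "b \<in> Sq" "Im b = 0" for b
  proof -
    \<comment> \<open>The point below \<open>b\<close> is clamped to the extent of the horizontal
      part, which misses the two corners by \<open>scale * s\<close> and
      \<open>scale * (1 - s)\<close>.\<close>
    define x where "x = max (scale * s) (min (Re b) (1 - scale * (1 - s)))"
    have "scale * s \<le> 1 - scale * (1 - s)" using scale_bounds by (simp add: algebra_simps)
    then have "Complex x (scale * t) \<in> polygon" by (intro bottom_in_polygon) (auto simp: x_def)
    moreover have "dist b (Complex x (scale * t)) \<le> 2 * scale"
    proof -
      have "\<bar>Re b - x\<bar> \<le> scale"
      proof -
        have "0 \<le> scale * s" "scale * s \<le> scale" "0 \<le> scale * (1 - s)" "scale * (1 - s) \<le> scale"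
          using scale_bounds t_pos t_less_s s_less mult_left_le[of _ scale] by auto
        then show ?thesis using b \<open>scale * s \<le> 1 - scale * (1 - s)\<close> unfolding x_def Sq_def by auto
      qed
      moreover have "0 \<le> scale * t" "scale * t \<le> scale"
        using scale_bounds t_pos t_less_s s_less by (auto intro: mult_left_le)
      ultimately show ?thesis using dist_le_abs[of b "Complex x (scale * t)"] b by simp
    qed
    ultimately show ?thesis by blast
  qed
  have rot: "\<exists>z\<in>polygon. dist b z \<le> 2 * scale" if near: "\<exists>z\<in>polygon. dist (R b) z \<le> 2 * scale" for b
  proof -
    obtain z where z: "z \<in> polygon" "dist (R b) z \<le> 2 * scale" using near by blast
    moreover from z obtain y where "y \<in> polygon" "z = R y" using R_polygon by blast
    ultimately show ?thesis using dist_R by metis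
  qed
  have "Im b = 0 \<or> Im (R b) = 0 \<or> Im (R (R b)) = 0 \<or> Im (R (R (R b))) = 0" "b \<in> Sq"
    using assms by (auto simp: frontier_Sq)
  then show ?thesis using bottom rot R_Sq_iff by metis
qed

lemma hausdorff_polygon: "0 \<le> hausdorff_dist polygon (frontier Sq)" "hausdorff_dist polygon (frontier Sq) \<le> 2 * scale"
proof -
  have "polygon \<noteq> {}" "frontier Sq \<noteq> {}" using zero_in_frontier_Sq by (auto simp: polygon_def)
  then show "0 \<le> hausdorff_dist polygon (frontier Sq)" "hausdorff_dist polygon (frontier Sq) \<le> 2 * scale"
    using hausdorff_dist_bounds polygon_near_frontier frontier_near_polygon by metis+
qed

end

section \<open>Choice of the angles and conclusion\<close>

lemma closing_angle_exists:
  assumes "K \<ge> 3"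
  shows "\<exists>\<theta>. pi/8 \<le> \<theta> \<and> \<theta> < pi/4 \<and>
    (1 - sin (2 * \<theta>)) * growth ((1 - sin (2 * \<theta>))\<^sup>2 / (sin \<theta> * cos \<theta> - (sin \<theta>)\<^sup>2)) K = 1"
proof -
  \<comment> \<open>At pi/4 the quotient in the statement is 0/0. With \<open>d\<close> it becomes
    \<open>d ^ 4 / (sin * d)\<close>; cancelling one factor makes \<open>g\<close> continuous on the
    closed interval, with value 0 at pi/4.\<close>
  define d where "d \<theta> = cos \<theta> - sin \<theta>" for \<theta> :: real
  define g where "g \<theta> = (1 - sin (2 * \<theta>)) * growth (d \<theta> ^ 3 / sin \<theta>) K" for \<theta>
  have d2: "1 - sin (2 * \<theta>) = (d \<theta>)\<^sup>2" for \<theta>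
    unfolding d_def sin_double using sin_cos_squared_add[of \<theta>] by algebra
  have sin_pos: "sin \<theta> > 0" if "pi/8 \<le> \<theta>" "\<theta> \<le> pi/4" for \<theta>
    using that pi_gt_zero by (intro sin_gt_zero) linarith+
  have cont_growth: "continuous_on {pi/8..pi/4} (\<lambda>\<theta>. growth (d \<theta> ^ 3 / sin \<theta>) n)" for n
    unfolding d_def
    by (induction n rule: induct_nat_012) (use sin_pos in \<open>fastforce intro!: continuous_intros\<close>)+
  have cont: "continuous_on {pi/8..pi/4} g"
    unfolding g_def by (intro continuous_intros cont_growth)
  have g4: "g (pi/4) = 0" by (simp add: g_def)
  \<comment> \<open>At pi/8 one has \<delta> equal to \<open>sqrt 2 - 1\<close> and
    \<open>growth \<delta> 3 = 2 + sqrt 2\<close>, so the equation holds exactly for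
    \<open>K = 3\<close>; a larger \<open>K\<close> only increases the left-hand side.\<close>
  have end0: "1 \<le> g (pi/8)"
  proof -
    define \<delta> where "\<delta> = d (pi/8) ^ 3 / sin (pi/8)"
    have s8: "sin (pi/8) > 0" by (rule sin_pos) auto
    have "cos (pi/8) > sin (pi/8)"
      using cos_monotone_0_pi[of "pi/8" "pi/4"] sin_monotone_2pi[of "pi/8" "pi/4"] by (simp add: sin_45 cos_45)
    then have d8: "d (pi/8) > 0" by (simp add: d_def)
    have sq: "(d (pi/8))\<^sup>2 = 1 - sqrt 2 / 2" using d2[of "pi/8"] by (simp add: sin_45)
    have sd: "sin (pi/8) * d (pi/8) = (sqrt 2 - 1) / 2"
      using sin_double[of "pi/8"] cos_double_sin[of "pi/8"]
      by (simp add: d_def sin_45 cos_45 algebra_simps power2_eq_square)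
    have "\<delta> = (d (pi/8))\<^sup>2 * (d (pi/8))\<^sup>2 / (sin (pi/8) * d (pi/8))"
      using s8 d8 by (simp add: \<delta>_def field_simps power2_eq_square power3_eq_cube)
    also have "\<dots> = sqrt 2 - 1"
    proof -
      have "sqrt 2 > 1" by simp
      have "(1 - sqrt 2 / 2) * (1 - sqrt 2 / 2) = (sqrt 2 - 1) * ((sqrt 2 - 1) / 2)"
        by (simp add: algebra_simps)
      then show ?thesis unfolding sq sd using \<open>sqrt 2 > 1\<close> by (simp add: nonzero_divide_eq_eq)
    qed
    finally have \<delta>: "\<delta> = sqrt 2 - 1" .
    have "1 = (1 - sqrt 2 / 2) * growth \<delta> 3"
      by (simp add: \<delta> numeral_3_eq_3 algebra_simps)
    also have "\<dots> \<le> (1 - sqrt 2 / 2) * growth \<delta> K"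
      using assms growth_mono[of \<delta> 3 K] \<delta> sqrt2_less_2 by (intro mult_left_mono) auto
    finally show ?thesis by (simp add: g_def \<delta>_def sin_45)
  qed
  obtain \<theta> where \<theta>: "pi/8 \<le> \<theta>" "\<theta> \<le> pi/4" "g \<theta> = 1"
    using IVT2'[of g "pi/4" 1 "pi/8"] end0 g4 cont by auto
  have "\<theta> \<noteq> pi/4" using \<theta>(3) g4 by (metis zero_neq_one)
  with \<theta>(2) have lt: "\<theta> < pi/4" by simp
  have "d \<theta> ^ 3 / sin \<theta> = (1 - sin (2 * \<theta>))\<^sup>2 / (sin \<theta> * cos \<theta> - (sin \<theta>)\<^sup>2)"
  proof -
    have "sin \<theta> * cos \<theta> - (sin \<theta>)\<^sup>2 = sin \<theta> * d \<theta>" by (simp add: d_def algebra_simps power2_eq_square)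
    then show ?thesis unfolding d2 by (simp add: power2_eq_square power3_eq_cube)
  qed
  then show ?thesis using \<theta> lt unfolding g_def by metis
qed

lemma pinwheel_angle:
  assumes "0 < \<theta>" "\<theta> < pi/4"
  shows "pinwheel \<theta> (sin \<theta> * cos \<theta>) ((sin \<theta>)\<^sup>2)"
proof
  have "sin \<theta> > 0" using assms by (intro sin_gt_zero) auto
  then show "0 < (sin \<theta>)\<^sup>2" by simp
  have lt: "sin \<theta> < cos \<theta>"
    using cos_monotone_0_pi[of \<theta> "pi/4"] sin_monotone_2pi[of \<theta> "pi/4"] assms by (simp add: sin_45 cos_45)
  then show "(sin \<theta>)\<^sup>2 < sin \<theta> * cos \<theta>" using \<open>sin \<theta> > 0\<close> by (simp add: power2_eq_square)
  have "0 < (cos \<theta> - sin \<theta>)\<^sup>2" using lt by simp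
  also have "\<dots> = 1 - 2 * (sin \<theta> * cos \<theta>)"
    using sin_cos_squared_add[of \<theta>] by (simp add: power2_eq_square algebra_simps)
  finally show "sin \<theta> * cos \<theta> < 1/2" by simp
qed auto

lemma closing_pinwheel_angle:
  assumes "K \<ge> 3" "0 < \<theta>" "\<theta> < pi/4"
    "(1 - sin (2 * \<theta>)) * growth ((1 - sin (2 * \<theta>))\<^sup>2 / (sin \<theta> * cos \<theta> - (sin \<theta>)\<^sup>2)) K = 1"
  shows "closing_pinwheel \<theta> (sin \<theta> * cos \<theta>) ((sin \<theta>)\<^sup>2) K"
proof -
  interpret pinwheel \<theta> "sin \<theta> * cos \<theta>" "(sin \<theta>)\<^sup>2" using assms by (intro pinwheel_angle)
  show ?thesis
    by unfold_locales (use assms in \<open>simp_all add: \<delta>_def sin_double mult.assoc\<close>)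
qed

lemma inverse_affine_tendsto_0:
  fixes c d :: real
  assumes "c > 0"
  shows "(\<lambda>n. 1 / (real n * c + d)) \<longlonglongrightarrow> 0"
proof -
  have "filterlim (\<lambda>n. d + real n * c) at_top sequentially"
    using assms by (intro filterlim_tendsto_add_at_top[OF tendsto_const]
        filterlim_at_top_mult_tendsto_pos[OF tendsto_const] filterlim_real_sequentially)
  then have "filterlim (\<lambda>n. real n * c + d) at_infinity sequentially"
    by (intro filterlim_at_top_imp_at_infinity) (simp add: add.commute)
  then show ?thesis by (intro tendsto_divide_0[OF tendsto_const])
qed

theorem theorem5p1:
  shows "\<exists>\<theta> :: nat \<Rightarrow> real.
    (\<forall>K\<ge>3. \<theta> K \<in> {0<..<pi/4}) \<and> \<theta> \<longlonglongrightarrow> pi/4 \<and>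
    (\<forall>K\<ge>3. \<exists>\<Gamma> :: nat \<Rightarrow> complex set.
       (\<forall>N. invariant_circle (F (\<theta> K)) (\<Gamma> N) \<and>
            has_rotation_number (F (\<theta> K)) (\<Gamma> N) (1 / (4 * (real K + real N))) \<and>
            finite_union_of_segments (\<Gamma> N) \<and>
            rotationally_symmetric (F (\<theta> K)) (\<Gamma> N)) \<and>
       (\<lambda>N. hausdorff_dist (\<Gamma> N) (frontier Sq)) \<longlonglongrightarrow> 0)"
proof -
  obtain \<theta> :: "nat \<Rightarrow> real" where \<theta>: "\<And>K. K \<ge> 3 \<Longrightarrow> pi/8 \<le> \<theta> K \<and> \<theta> K < pi/4 \<and>
    (1 - sin (2 * \<theta> K)) * growth ((1 - sin (2 * \<theta> K))\<^sup>2 / (sin (\<theta> K) * cos (\<theta> K) - (sin (\<theta> K))\<^sup>2)) K = 1"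
    using closing_angle_exists by metis
  have pos: "0 < \<theta> K" if "K \<ge> 3" for K using \<theta>[OF that] pi_gt_zero by linarith
  have angle: "closing_pinwheel (\<theta> K) (sin (\<theta> K) * cos (\<theta> K)) ((sin (\<theta> K))\<^sup>2) K" if "K \<ge> 3" for K
    using \<theta>[OF that] pos[OF that] that by (intro closing_pinwheel_angle) auto
  have "\<theta> \<longlonglongrightarrow> pi/4"
  proof -
    \<comment> \<open>The closing equation and the linear lower bound of \<open>growth\<close> force
      \<open>1 - sin (2 * \<theta> K)\<close> below \<open>1 / (K - 1)\<close>.\<close>
    have bound: "norm (sin (2 * \<theta> K) - 1) \<le> 1 / (real K - 1)" if K: "K \<ge> 3" for K
    proof -
      interpret closing_pinwheel "\<theta> K" "sin (\<theta> K) * cos (\<theta> K)" "(sin (\<theta> K))\<^sup>2" K by (rule angle[OF K])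
      have "(1 - sin (2 * \<theta> K)) * (real K - 1) \<le> (1 - sin (2 * \<theta> K)) * growth \<delta> K"
        using growth_lower_bound[of \<delta> K] \<delta>_pos by (intro mult_left_mono) auto
      also have "\<dots> = 1" using closing by (simp add: sin_double mult.assoc)
      finally show ?thesis using K by (simp add: field_simps)
    qed
    have "(\<lambda>K. 1 / (real K - 1)) \<longlonglongrightarrow> 0"
      using inverse_affine_tendsto_0[of 1 "- 1"] by simp
    moreover have "\<forall>\<^sub>F K in sequentially. norm (sin (2 * \<theta> K) - 1) \<le> 1 / (real K - 1)"
      using eventually_ge_at_top[of 3] by (rule eventually_mono) (rule bound)
    ultimately have "(\<lambda>K. sin (2 * \<theta> K) - 1) \<longlonglongrightarrow> 0"
      by (rule Lim_null_comparison[rotated])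
    then have "(\<lambda>K. sin (2 * \<theta> K)) \<longlonglongrightarrow> 1" by (simp add: LIM_zero_iff)
    \<comment> \<open>The angle is recovered by \<open>arcsin\<close> because
      \<open>2 * \<theta> K\<close> lies below pi/2. Values for \<open>K < 3\<close> are
      unspecified, hence the eventual equality.\<close>
    then have "(\<lambda>K. arcsin (sin (2 * \<theta> K))) \<longlonglongrightarrow> arcsin 1"
      by (intro continuous_on_tendsto_compose[OF continuous_on_arcsin']) auto
    then have "(\<lambda>K. arcsin (sin (2 * \<theta> K)) / 2) \<longlonglongrightarrow> pi / 2 / 2"
      by (intro tendsto_intros) auto
    moreover have "\<forall>\<^sub>F K in sequentially. arcsin (sin (2 * \<theta> K)) / 2 = \<theta> K"
      using eventually_ge_at_top[of 3]
    proof eventually_elim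
      case (elim K)
      then have "arcsin (sin (2 * \<theta> K)) = 2 * \<theta> K" using \<theta>[OF elim] pos[OF elim] by (intro arcsin_sin) auto
      then show ?case by simp
    qed
    ultimately show ?thesis using Lim_transform_eventually by fastforce
  qed
  moreover have "\<exists>\<Gamma> :: nat \<Rightarrow> complex set.
       (\<forall>N. invariant_circle (F (\<theta> K)) (\<Gamma> N) \<and>
            has_rotation_number (F (\<theta> K)) (\<Gamma> N) (1 / (4 * (real K + real N))) \<and>
            finite_union_of_segments (\<Gamma> N) \<and>
            rotationally_symmetric (F (\<theta> K)) (\<Gamma> N)) \<and>
       (\<lambda>N. hausdorff_dist (\<Gamma> N) (frontier Sq)) \<longlonglongrightarrow> 0" if K: "K \<ge> 3" for K
  proof -
    interpret closing_pinwheel "\<theta> K" "sin (\<theta> K) * cos (\<theta> K)" "(sin (\<theta> K))\<^sup>2" K by (rule angle[OF K])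
    have orbit: "closing_orbit (\<theta> K) (sin (\<theta> K) * cos (\<theta> K)) ((sin (\<theta> K))\<^sup>2) K" by unfold_locales
    have "\<exists>\<Gamma>. invariant_circle (F (\<theta> K)) \<Gamma> \<and>
        has_rotation_number (F (\<theta> K)) \<Gamma> (1 / (4 * (real K + real N))) \<and>
        finite_union_of_segments \<Gamma> \<and> rotationally_symmetric (F (\<theta> K)) \<Gamma> \<and>
        0 \<le> hausdorff_dist \<Gamma> (frontier Sq) \<and>
        hausdorff_dist \<Gamma> (frontier Sq) \<le> 2 * (1 / (real N * (1 - 2 * (sin (\<theta> K) * cos (\<theta> K))) + 1))" for N
    proof -
      interpret closing_orbit "\<theta> K" "sin (\<theta> K) * cos (\<theta> K)" "(sin (\<theta> K))\<^sup>2" K N by (rule orbit)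
      show ?thesis
        using invariant_polygon rotation_number_polygon finite_union_polygon symmetric_polygon hausdorff_polygon
        unfolding scale_def l_def of_nat_add by blast
    qed
    then obtain \<Gamma> where \<Gamma>: "\<And>N. invariant_circle (F (\<theta> K)) (\<Gamma> N) \<and>
        has_rotation_number (F (\<theta> K)) (\<Gamma> N) (1 / (4 * (real K + real N))) \<and>
        finite_union_of_segments (\<Gamma> N) \<and> rotationally_symmetric (F (\<theta> K)) (\<Gamma> N) \<and>
        0 \<le> hausdorff_dist (\<Gamma> N) (frontier Sq) \<and>
        hausdorff_dist (\<Gamma> N) (frontier Sq) \<le> 2 * (1 / (real N * (1 - 2 * (sin (\<theta> K) * cos (\<theta> K))) + 1))"
      by metis
    have "(\<lambda>N. 2 * (1 / (real N * c + 1))) \<longlonglongrightarrow> 0" if "c > 0" for c :: real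
      using tendsto_mult_left[OF inverse_affine_tendsto_0[OF that], of 2 1] by simp
    from this[of "1 - 2 * (sin (\<theta> K) * cos (\<theta> K))"]
    have "(\<lambda>N. 2 * (1 / (real N * (1 - 2 * (sin (\<theta> K) * cos (\<theta> K))) + 1))) \<longlonglongrightarrow> 0"
      using s_less by simp
    then have "(\<lambda>N. hausdorff_dist (\<Gamma> N) (frontier Sq)) \<longlonglongrightarrow> 0"
      by (rule Lim_null_comparison[rotated]) (use \<Gamma> in auto)
    then show ?thesis using \<Gamma> by blast
  qed
  ultimately show ?thesis using \<theta> pos by (intro exI[of _ \<theta>]) auto
qed

end
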